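(* Let $s,t>0$ satisfy $s+t>1$, let $c_\alpha\in\mathbf C$ for $\alpha\in\mathbf N^d$, and suppose that $$\sum_{\alpha\in\mathbf N^d}|c_\alpha|\,r^{|\alpha|}\alpha!^s<\infty\quad\text{for all } r>0.$$ Define $u\in(\Sigma_t^s)'(\mathbf R^d)$ and $f\in(\Sigma_s^t)'(\mathbf R^d)$ by $$u=\sum_{\alpha\in\mathbf N^d}c_\alpha D^\alpha\delta_0,\qquad f(x)=\sum_{\alpha\in\mathbf N^d}c_\alpha x^\alpha.$$ Then $$\mathrm{WF}^{t,s}(u)\subseteq\{0\}\times(\mathbf R^d\setminus0)\quad\text{and}\quad\mathrm{WF}^{s,t}(f)\subseteq(\mathbf R^d\setminus0)\times\{0\}.$$
   Context: Notation: $\mathbf N=\{0,1,2,\dots\}$, $D^\beta=(-i)^{|\beta|}\partial^\beta$, $\delta_0$ is the Dirac distribution at $0$, $T^*\mathbf R^d\simeq\mathbf R^{2d}$. For $s,t>0$ with $s+t>1$, the (Beurling type) Gelfand--Shilov space $\Sigma_t^s(\mathbf R^d)$ consists of all $f\in C^\infty(\mathbf R^d)$ such that for every $h>0$ $$\|f\|_{\mathcal S_{t,h}^s}=\sup_{\alpha,\beta\in\mathbf N^d,\,x\in\mathbf R^d}\frac{|x^\alpha D^\beta f(x)|}{h^{|\alpha+\beta|}\alpha!^t\beta!^s}<\infty,$$ with the Fréchet topology given by these seminorms. $(\Sigma_t^s)'(\mathbf R^d)$ is its topological dual; the action $(u,\varphi)$ is conjugate linear in $\varphi$ and consistent with the $L^2$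 inner product; in particular $(D^\alpha\delta_0,\varphi)=\overline{D^\alpha\varphi(0)}$. Under the summability condition the series for $u$ converges in $(\Sigma_t^s)'(\mathbf R^d)$, the series for $f$ converges in $(\Sigma_s^t)'(\mathbf R^d)$ (and absolutely pointwise), and $\widehat u=(2\pi)^{-d/2}f$, where $\widehat g(\xi)=(2\pi)^{-d/2}\int g(x)e^{-i\langle x,\xi\rangle}dx$ is extended to ultradistributions by duality. Short-time Fourier transform: with $T_xf(y)=f(y-x)$, $M_\xi f(y)=e^{i\langle y,\xi\rangle}f(y)$, set $V_\psi u(x,\xi)=(2\pi)^{-d/2}(u,M_\xi T_x\psi)$. Wave front set: for $u\in(\Sigma_t^s)'(\mathbf R^d)$ and a fixed $\psi\in\Sigma_t^s(\mathbf R^d)\setminus\{0\}$, $(x_0,\xi_0)\in T^*\mathbf R^d\setminus0$ satisfies $(x_0,\xi_0)\notin\mathrm{WF}^{t,s}(u)$ if there is an open set $U\subseteq T^*\mathbf R^d\setminus0$ containing $(x_0,\xi_0)$ such that $$\sup_{\lambda>0,\,(x,\xi)\in U}e^{r\lambda}|V_\psi u(\lambda^tx,\lambda^s\xi)|<\infty\quad\forall r>0.$$ The definition does not depend on the choice of $\psi$. $\mathrm{WF}^{s,t}$ (for elements of $(\Sigma_s^t)'(\mathbf R^d)$) is obtained by exchanging the roles of $s$ and $t$. *)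

theory Defs
  imports "HOL-Analysis.Analysis"
begin

text \<open>
  \<open>\<real>\<^sup>d\<close> is \<^typ>\<open>real ^ 'd\<close> with \<open>d = CARD('d)\<close>; multi-indices are functions \<^typ>\<open>'d \<Rightarrow> nat\<close>.
\<close>

type_synonym 'd multiindex = "'d \<Rightarrow> nat"

definition mi_abs :: "'d::finite multiindex \<Rightarrow> nat" where
  "mi_abs \<alpha> = (\<Sum>i\<in>UNIV. \<alpha> i)"

definition mi_fact :: "'d::finite multiindex \<Rightarrow> real" where
  "mi_fact \<alpha> = (\<Prod>i\<in>UNIV. fact (\<alpha> i))"

definition mi_pow :: "real ^ 'd::finite \<Rightarrow> 'd multiindex \<Rightarrow> real" where
  "mi_pow x \<alpha> = (\<Prod>i\<in>UNIV. (x $ i) ^ \<alpha> i)"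

definition partial_deriv :: "'d \<Rightarrow> (real ^ 'd::finite \<Rightarrow> complex) \<Rightarrow> (real ^ 'd \<Rightarrow> complex)" where
  "partial_deriv i f = (\<lambda>x. frechet_derivative f (at x) (axis i 1))"

text \<open>
  \<open>C\<^sup>\<infinity>\<close>: every iterated partial derivative, in any order, is totally differentiable everywhere.
  Since total differentiability implies continuity, and continuous partial derivatives imply total
  differentiability, this is the same as all iterated partial derivatives existing and being
  continuous.
\<close>

definition smooth :: "(real ^ 'd::finite \<Rightarrow> complex) \<Rightarrow> bool" where
  "smooth f \<longleftrightarrow> (\<forall>is x. foldr partial_deriv is f differentiable (at x))"

text \<open>
  The index type carries no order, so \<open>\<partial>\<^sup>\<beta> = \<partial>\<^sub>1\<^bsup>\<beta> 1\<^esup> \<dots> \<partial>\<^sub>d\<^bsup>\<beta> d\<^esup>\<close> is taken along an arbitrary but fixed enumeration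
  of the coordinates; for smooth functions the choice is immaterial by symmetry of derivatives.
\<close>

definition coords :: "'d::finite list" where
  "coords = (SOME is. distinct is \<and> set is = UNIV)"

definition mi_deriv :: "'d::finite multiindex \<Rightarrow> (real ^ 'd \<Rightarrow> complex) \<Rightarrow> (real ^ 'd \<Rightarrow> complex)" where
  "mi_deriv \<beta> f = foldr (\<lambda>i. partial_deriv i ^^ \<beta> i) coords f"

definition mi_D :: "'d::finite multiindex \<Rightarrow> (real ^ 'd \<Rightarrow> complex) \<Rightarrow> (real ^ 'd \<Rightarrow> complex)" where
  "mi_D \<beta> f = (\<lambda>x. (- \<i>) ^ mi_abs \<beta> * mi_deriv \<beta> f x)"

text \<open>
  In \<open>gs_seminorm t s h\<close>, \<open>gs_space t s\<close> etc. the first parameter \<open>t\<close> (subscript of \<open>\<Sigma>\<close>) governs decay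
  and the second parameter \<open>s\<close> (superscript) governs regularity.
\<close>

definition gs_seminorm :: "real \<Rightarrow> real \<Rightarrow> real \<Rightarrow> (real ^ 'd::finite \<Rightarrow> complex) \<Rightarrow> ennreal" where
  "gs_seminorm t s h f =
     (SUP (\<alpha>, \<beta>, x). ennreal (cmod (of_real (mi_pow x \<alpha>) * mi_D \<beta> f x) /
        (h ^ (mi_abs \<alpha> + mi_abs \<beta>) * mi_fact \<alpha> powr t * mi_fact \<beta> powr s)))"

definition gs_space :: "real \<Rightarrow> real \<Rightarrow> (real ^ 'd::finite \<Rightarrow> complex) set" where
  "gs_space t s = {f. smooth f \<and> (\<forall>h>0. gs_seminorm t s h f < \<infinity>)}"

definition gs_ball ::
  "real \<Rightarrow> real \<Rightarrow> (real ^ 'd::finite \<Rightarrow> complex) \<Rightarrow> real \<Rightarrow> real \<Rightarrow> (real ^ 'd \<Rightarrow> complex) set" where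
  "gs_ball t s f h \<epsilon> = {g \<in> gs_space t s. gs_seminorm t s h (\<lambda>x. g x - f x) < ennreal \<epsilon>}"

definition gs_topology :: "real \<Rightarrow> real \<Rightarrow> (real ^ 'd::finite \<Rightarrow> complex) topology" where
  "gs_topology t s = topology_generated_by
     {gs_ball t s f h \<epsilon> | f h \<epsilon>. f \<in> gs_space t s \<and> h > 0 \<and> \<epsilon> > 0}"

type_synonym 'd functional = "(real ^ 'd \<Rightarrow> complex) \<Rightarrow> complex"

text \<open>
  \<open>u \<phi>\<close> is the action \<open>(u, \<phi>)\<close>, which is conjugate linear in \<open>\<phi>\<close>. Values outside the test function
  space are irrelevant.
\<close>

definition gs_dual :: "real \<Rightarrow> real \<Rightarrow> 'd::finite functional set" where
  "gs_dual t s = {u.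
     (\<forall>\<phi>\<in>gs_space t s. \<forall>\<eta>\<in>gs_space t s. \<forall>a b.
        u (\<lambda>x. a * \<phi> x + b * \<eta> x) = cnj a * u \<phi> + cnj b * u \<eta>) \<and>
     continuous_map (gs_topology t s) euclidean u}"

text \<open>Unconditional convergence of a series in the dual, with respect to its weak* topology.\<close>

definition gs_dual_has_sum ::
  "real \<Rightarrow> real \<Rightarrow> ('i \<Rightarrow> 'd::finite functional) \<Rightarrow> 'd functional \<Rightarrow> bool" where
  "gs_dual_has_sum t s v u \<longleftrightarrow>
     (\<forall>i. v i \<in> gs_dual t s) \<and> u \<in> gs_dual t s \<and>
     (\<forall>\<phi>\<in>gs_space t s. ((\<lambda>i. v i \<phi>) has_sum u \<phi>) UNIV)"

definition dirac0 :: "'d::finite functional" where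
  "dirac0 \<phi> = cnj (\<phi> 0)"

text \<open>No sign appears here, since \<open>D\<^sup>\<alpha>\<close> is symmetric for the sesquilinear \<open>L\<^sup>2\<close> pairing.\<close>

definition dual_D :: "'d::finite multiindex \<Rightarrow> 'd functional \<Rightarrow> 'd functional" where
  "dual_D \<alpha> u = (\<lambda>\<phi>. u (mi_D \<alpha> \<phi>))"

text \<open>The ultradistribution given by a function, via the \<open>L\<^sup>2\<close> inner product.\<close>

definition fun_dual :: "(real ^ 'd::finite \<Rightarrow> complex) \<Rightarrow> 'd functional" where
  "fun_dual f = (\<lambda>\<phi>. LINT x|lborel. f x * cnj (\<phi> x))"

definition translate :: "real ^ 'd::finite \<Rightarrow> (real ^ 'd \<Rightarrow> complex) \<Rightarrow> (real ^ 'd \<Rightarrow> complex)" where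
  "translate x f = (\<lambda>y. f (y - x))"

definition modulate :: "real ^ 'd::finite \<Rightarrow> (real ^ 'd \<Rightarrow> complex) \<Rightarrow> (real ^ 'd \<Rightarrow> complex)" where
  "modulate \<xi> f = (\<lambda>y. exp (\<i> * of_real (y \<bullet> \<xi>)) * f y)"

definition stft ::
  "(real ^ 'd::finite \<Rightarrow> complex) \<Rightarrow> 'd functional \<Rightarrow> real ^ 'd \<Rightarrow> real ^ 'd \<Rightarrow> complex" where
  "stft \<psi> u x \<xi> =
     of_real ((2 * pi) powr (- real CARD('d) / 2)) * u (modulate \<xi> (translate x \<psi>))"

text \<open>
  \<open>wave_front t s \<psi> u\<close> is \<open>WF\<^bsup>t,s\<^esup>(u)\<close> computed with the window \<open>\<psi>\<close>, meant for \<open>u \<in> gs_dual t s\<close> and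
  \<open>0 \<noteq> \<psi> \<in> gs_space t s\<close>.
\<close>

definition wave_front ::
  "real \<Rightarrow> real \<Rightarrow> (real ^ 'd::finite \<Rightarrow> complex) \<Rightarrow> 'd functional \<Rightarrow> ((real ^ 'd) \<times> (real ^ 'd)) set" where
  "wave_front t s \<psi> u = {z \<in> - {(0, 0)}.
     \<not> (\<exists>U. open U \<and> U \<subseteq> - {(0, 0)} \<and> z \<in> U \<and>
          (\<forall>r>0. bdd_above {exp (r * \<rho>) * cmod (stft \<psi> u (\<rho> powr t *\<^sub>R x) (\<rho> powr s *\<^sub>R \<xi>))
                            | \<rho> x \<xi>. \<rho> > 0 \<and> (x, \<xi>) \<in> U}))}"

end

theory Submission
  imports Defs "HOL-Probability.Sinc_Integral"
begin

text \<open>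
  Write \<open>W s x = \<Sum>\<^sub>i \<bar>x\<^sub>i\<bar>\<^bsup>1/s\<^esup>\<close>. The moment bounds \<open>\<bar>a\<bar>\<^sup>n v \<le> C h\<^sup>n n!\<^sup>t\<close> for all \<open>n\<close> amount to decay of
  \<open>v\<close> like \<open>exp (- A W t a)\<close> with \<open>A\<close> arbitrarily large when \<open>h\<close> is small, whereas
  \<open>\<bar>x\<^sup>\<alpha>\<bar> \<le> \<alpha>!\<^sup>s exp (s W s x)\<close>. Since \<open>W t (\<rho>\<^sup>t x) = \<rho> W t x\<close>, both inclusions follow from estimates of
  the short-time Fourier transform by \<open>C exp (B W s y - A W t z)\<close> with \<open>B\<close> fixed and \<open>A\<close> arbitrary.
  For \<open>u\<close>, where \<open>(y, z) = (\<xi>, x)\<close>, this is the Leibniz rule for \<open>D\<^sup>\<alpha>\<close> of the shifted window at \<open>0\<close>: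
  powers of \<open>\<xi>\<close> are absorbed by \<open>\<alpha>!\<^sup>s\<close>, and the window decays in \<open>x\<close>. For \<open>f\<close>, where
  \<open>(y, z) = (x, \<xi>)\<close>, one multiplies by \<open>\<xi>\<^sub>i\<^sup>n\<close> and integrates by parts term by term; a derivative of
  order \<open>k\<close> falling on \<open>y\<^sup>\<alpha>\<close> costs \<open>k! \<le> k!\<^sup>s k!\<^sup>t\<close>.
\<close>

section \<open>Factorials, moments and exponential weights\<close>

text \<open>The order of choices shapes both estimates. One neighbourhood has to serve every decay
  rate r. Near a point with z \<noteq> 0, the scaled B W s y is at most a fixed multiple of \<rho>,
  whereas A W t z is at least A times another positive multiple. So A can be chosen after r and B,
  but the argument would collapse if B grew with A. For u the rate A comes from the window alone,
  and B = s d collects one factor exp (s W s \<xi>) per coordinate. For f the rate A is bought with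
  derivatives of the window, hence with small h. Every derivative spent on the monomial instead
  loses a factor h, which with the binomial coefficients costs at most (2/h)^|\<alpha>|; summability
  against every r^|\<alpha>| pays for this. There B = 2^(1/s) (s + 1): s absorbs the monomial, 1
  leaves an integrable weight, and 2^(1/s) comes from moving the decay of the window from y - x to
  y.\<close>

lemma powr_root_power:
  fixes a :: real
  assumes "a \<ge> 0"
  shows "(a powr r) ^ n = (a ^ n) powr r"
  using assms by (induction n) (auto simp: powr_mult)

text \<open>The quotient is a binomial coefficient, hence at least 1. Raised to a power, this
  recombines the Gevrey factors that a Leibniz sum has split.\<close>

lemma fact_mult_le: "(fact k :: real) * fact (n - k) \<le> fact n" if "k \<le> n"
proof -
  have "real (fact k * fact (n - k) * 1) \<le> real (fact k * fact (n - k) * (n choose k))"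
    using that by (intro of_nat_mono mult_left_mono) (auto simp: Suc_le_eq)
  also have "\<dots> = real (fact n)"
    using binomial_fact_lemma[OF that] by simp
  finally show ?thesis by simp
qed

text \<open>For \<open>s = 1\<close>, one term of the exponential series is at most its sum. The
  general case is the \<open>s\<close>-th power of this at \<open>a powr (1/s)\<close>.\<close>

lemma power_le_fact_powr_exp:
  fixes a s :: real
  assumes "a \<ge> 0" "s > 0"
  shows "a ^ n \<le> fact n powr s * exp (s * a powr (1/s))"
proof -
  let ?b = "a powr (1/s)"
  have sums: "(\<lambda>k. ?b ^ k /\<^sub>R fact k) sums exp ?b"
    by (rule exp_converges)
  have "?b ^ n /\<^sub>R fact n \<le> exp ?b"
    using sum_le_suminf[OF sums_summable[OF sums], of "{n}"] sums_unique[OF sums] by auto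
  hence "?b ^ n \<le> fact n * exp ?b"
    by (simp add: field_simps)
  hence "(?b ^ n) powr s \<le> (fact n * exp ?b) powr s"
    using assms by (intro powr_mono2) auto
  also have "(?b ^ n) powr s = a ^ n"
    using assms by (simp add: powr_root_power powr_powr)
  finally show ?thesis
    by (simp add: powr_mult exp_powr_real mult.commute)
qed

text \<open>The \<open>t\<close>-th roots of the hypotheses, weighted by \<open>2\<^sup>-\<^sup>n\<close>, add up to an exponential series.\<close>

lemma moments_imp_exp_decay:
  fixes a v C h t :: real
  assumes t: "t > 0" and h: "h > 0" and nonneg: "a \<ge> 0" "v \<ge> 0" "C \<ge> 0"
    and mom: "\<And>n. a ^ n * v \<le> C * h ^ n * fact n powr t"
  shows "v \<le> 2 powr t * C * exp (- (t / (2 * h powr (1/t)) * a powr (1/t)))"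
proof -
  let ?b = "a powr (1/t) / (2 * h powr (1/t))"
  have term_le: "v powr (1/t) * (?b ^ n /\<^sub>R fact n) \<le> C powr (1/t) * (1/2) ^ n" for n
  proof -
    have "(a ^ n * v) powr (1/t) \<le> (C * h ^ n * fact n powr t) powr (1/t)"
      using t nonneg mom by (intro powr_mono2) auto
    hence "(a powr (1/t)) ^ n * v powr (1/t) \<le> C powr (1/t) * (h powr (1/t)) ^ n * fact n"
      using t nonneg h by (simp add: powr_mult powr_powr powr_root_power)
    thus ?thesis
      using h by (simp add: field_simps power_mult_distrib power_divide)
  qed
  have "(\<lambda>n. v powr (1/t) * (?b ^ n /\<^sub>R fact n)) sums (v powr (1/t) * exp ?b)"
    by (intro sums_mult exp_converges)
  \<comment> \<open>The value 2 of this geometric series, raised to the power \<open>t\<close>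
    below, is the factor \<open>2 powr t\<close> of the conclusion.\<close>
  moreover have "(\<lambda>n. C powr (1/t) * (1/2) ^ n) sums (C powr (1/t) * 2)"
    using sums_mult[OF geometric_sums[of "1/2::real"], of "C powr (1/t)"] by simp
  ultimately have "v powr (1/t) * exp ?b \<le> C powr (1/t) * 2"
    by (rule sums_le[OF term_le])
  hence "(v powr (1/t) * exp ?b) powr t \<le> (C powr (1/t) * 2) powr t"
    using t by (intro powr_mono2) auto
  hence "v * exp (t * ?b) \<le> C * 2 powr t"
    using t nonneg by (simp add: powr_mult powr_powr exp_powr_real mult.commute)
  hence "v \<le> C * 2 powr t * exp (- (t * ?b))"
    by (simp add: exp_minus field_simps)
  thus ?thesis
    by (simp add: mult_ac)
qed

definition gs_weight :: "real \<Rightarrow> real ^ 'd::finite \<Rightarrow> real" where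
  "gs_weight s x = (\<Sum>i\<in>UNIV. \<bar>x $ i\<bar> powr (1/s))"

lemma gs_weight_uminus [simp]: "gs_weight s (- x) = gs_weight s x"
  unfolding gs_weight_def by simp

lemma gs_weight_component: "\<bar>x $ i\<bar> powr (1/s) \<le> gs_weight s x"
  unfolding gs_weight_def by (intro member_le_sum) auto

text \<open>Since \<open>1/s\<close> may exceed 1, the power is only quasi-subadditive; the constant
  comes from bounding a sum by twice the maximum.\<close>

lemma gs_weight_add:
  assumes "s > 0"
  shows "gs_weight s (x + y) \<le> 2 powr (1/s) * (gs_weight s x + gs_weight s y)"
proof -
  have "\<bar>(x + y) $ i\<bar> powr (1/s) \<le> 2 powr (1/s) * (\<bar>x $ i\<bar> powr (1/s) + \<bar>y $ i\<bar> powr (1/s))" for i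
  proof -
    let ?m = "max \<bar>x $ i\<bar> \<bar>y $ i\<bar>"
    have "\<bar>(x + y) $ i\<bar> powr (1/s) \<le> (2 * ?m) powr (1/s)"
      using assms by (intro powr_mono2) auto
    also have "\<dots> = 2 powr (1/s) * ?m powr (1/s)"
      by (simp add: powr_mult)
    also have "?m powr (1/s) \<le> \<bar>x $ i\<bar> powr (1/s) + \<bar>y $ i\<bar> powr (1/s)"
      by (simp add: max_def)
    finally show ?thesis by simp
  qed
  thus ?thesis
    unfolding gs_weight_def sum.distrib[symmetric] sum_distrib_left by (intro sum_mono)
qed

text \<open>The weight is comparable to its largest summand, so the moments in single coordinates suffice.\<close>

lemma moments_imp_weight_decay:
  fixes t A h\<^sub>0 :: real
  assumes "t > 0" "A > 0" "h\<^sub>0 > 0"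
  obtains h where "h > 0" "h \<le> h\<^sub>0"
    "\<And>(x :: real ^ 'd::finite) v C. v \<ge> 0 \<Longrightarrow> C \<ge> 0 \<Longrightarrow>
       (\<And>i n. \<bar>x $ i\<bar> ^ n * v \<le> C * h ^ n * fact n powr t) \<Longrightarrow>
       v \<le> 2 powr t * C * exp (- (A * gs_weight t x))"
proof -
  let ?d = "real CARD('d)"
  \<comment> \<open>Solves \<open>A * CARD('d) \<le> t / (2 * h powr (1/t))\<close>, whose
    right-hand side is the rate in \<open>moments_imp_exp_decay\<close>; \<open>CARD('d)\<close>
    pays for passing from the largest coordinate to the sum.\<close>
  define h where "h = min h\<^sub>0 ((t / (2 * A * ?d)) powr t)"
  have h: "h > 0" "h \<le> h\<^sub>0"
    using assms by (auto simp: h_def)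
  have "h powr (1/t) \<le> ((t / (2 * A * ?d)) powr t) powr (1/t)"
    using assms h by (intro powr_mono2) (auto simp: h_def)
  also have "\<dots> = t / (2 * A * ?d)"
    using assms by (simp add: powr_powr)
  finally have rate: "A * ?d \<le> t / (2 * h powr (1/t))"
    using assms h by (simp add: field_simps)
  show ?thesis
  proof (rule that[OF h])
    fix x :: "real ^ 'd" and v C :: real
    assume nonneg: "v \<ge> 0" "C \<ge> 0"
      and mom: "\<And>i n. \<bar>x $ i\<bar> ^ n * v \<le> C * h ^ n * fact n powr t"
    obtain i where i: "\<And>j. \<bar>x $ j\<bar> powr (1/t) \<le> \<bar>x $ i\<bar> powr (1/t)"
    proof -
      have "Max (range (\<lambda>j. \<bar>x $ j\<bar> powr (1/t))) \<in> range (\<lambda>j. \<bar>x $ j\<bar> powr (1/t))"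
        by (intro Max_in) auto
      then obtain i where "Max (range (\<lambda>j. \<bar>x $ j\<bar> powr (1/t))) = \<bar>x $ i\<bar> powr (1/t)"
        by (elim imageE)
      thus ?thesis
        by (intro that[of i]) (metis Max_ge finite finite_imageI rangeI)
    qed
    have "gs_weight t x \<le> (\<Sum>j\<in>(UNIV :: 'd set). \<bar>x $ i\<bar> powr (1/t))"
      unfolding gs_weight_def using i by (intro sum_mono)
    hence "A * gs_weight t x \<le> A * (?d * \<bar>x $ i\<bar> powr (1/t))"
      using assms by (intro mult_left_mono) auto
    also have "\<dots> \<le> t / (2 * h powr (1/t)) * \<bar>x $ i\<bar> powr (1/t)"
      using mult_right_mono[OF rate, of "\<bar>x $ i\<bar> powr (1/t)"] by (simp add: mult_ac)
    finally have weight: "A * gs_weight t x \<le> t / (2 * h powr (1/t)) * \<bar>x $ i\<bar> powr (1/t)" .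
    have "v \<le> 2 powr t * C * exp (- (t / (2 * h powr (1/t)) * \<bar>x $ i\<bar> powr (1/t)))"
      using assms h nonneg mom by (intro moments_imp_exp_decay) auto
    also have "\<dots> \<le> 2 powr t * C * exp (- (A * gs_weight t x))"
      using weight nonneg by (intro mult_left_mono) auto
    finally show "v \<le> 2 powr t * C * exp (- (A * gs_weight t x))" .
  qed
qed

lemma gs_weight_scale_le:
  assumes "s > 0" "\<rho> > 0" "\<And>i. \<bar>x $ i\<bar> \<le> R"
  shows "gs_weight s (\<rho> powr s *\<^sub>R x :: real ^ 'd::finite) \<le> CARD('d) * R powr (1/s) * \<rho>"
proof -
  have "\<bar>(\<rho> powr s *\<^sub>R x) $ i\<bar> powr (1/s) \<le> R powr (1/s) * \<rho>" for i
  proof -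
    have "\<bar>(\<rho> powr s *\<^sub>R x) $ i\<bar> powr (1/s) = \<bar>x $ i\<bar> powr (1/s) * \<rho>"
      using assms(1,2) by (simp add: abs_mult powr_mult powr_powr mult.commute)
    also have "\<dots> \<le> R powr (1/s) * \<rho>"
      using assms by (intro mult_right_mono powr_mono2) auto
    finally show ?thesis .
  qed
  hence "gs_weight s (\<rho> powr s *\<^sub>R x) \<le> (\<Sum>i\<in>(UNIV :: 'd set). R powr (1/s) * \<rho>)"
    unfolding gs_weight_def by (intro sum_mono)
  thus ?thesis by simp
qed

section \<open>Multi-index arithmetic and monomials\<close>

lemma mi_fact_pos [simp]: "mi_fact \<alpha> > 0"
  unfolding mi_fact_def by (intro prod_pos) auto

lemma mi_fact_nonzero [simp]: "mi_fact \<alpha> \<noteq> 0"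
  by (metis less_irrefl mi_fact_pos)

lemma abs_mi_pow: "\<bar>mi_pow x \<alpha>\<bar> = (\<Prod>i\<in>UNIV. \<bar>x $ i\<bar> ^ \<alpha> i)"
  unfolding mi_pow_def by (simp add: abs_prod power_abs)

lemma mi_fact_powr: "mi_fact \<alpha> powr s = (\<Prod>i\<in>UNIV. fact (\<alpha> i) powr s)"
  unfolding mi_fact_def by (simp add: prod_powr_distrib)

lemma power_mi_abs: "r ^ mi_abs \<alpha> = (\<Prod>i\<in>UNIV. r ^ \<alpha> i)"
  unfolding mi_abs_def by (simp add: power_sum)

lemma mi_pow_le_weight:
  assumes "s > 0"
  shows "\<bar>mi_pow x \<alpha>\<bar> \<le> mi_fact \<alpha> powr s * exp (s * gs_weight s x)"
proof -
  have "\<bar>mi_pow x \<alpha>\<bar> \<le> (\<Prod>i\<in>UNIV. fact (\<alpha> i) powr s * exp (s * \<bar>x $ i\<bar> powr (1/s)))"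
    unfolding abs_mi_pow using assms by (intro prod_mono) (auto intro: power_le_fact_powr_exp)
  also have "\<dots> = mi_fact \<alpha> powr s * exp (s * gs_weight s x)"
    by (simp add: prod.distrib mi_fact_powr gs_weight_def sum_distrib_left exp_sum)
  finally show ?thesis .
qed

definition mi_single :: "'d \<Rightarrow> nat \<Rightarrow> 'd::finite multiindex" where
  "mi_single i n = (\<lambda>j. if j = i then n else 0)"

lemma mi_abs_single [simp]: "mi_abs (mi_single i n) = n"
  unfolding mi_abs_def mi_single_def by simp

lemma mi_fact_single [simp]: "mi_fact (mi_single i n) = fact n"
  unfolding mi_fact_def mi_single_def by (simp add: if_distrib [where f = fact] cong: if_cong)

lemma mi_pow_single [simp]: "mi_pow x (mi_single i n) = x $ i ^ n"
  unfolding mi_pow_def mi_single_def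
  by (simp add: if_distrib [where f = "\<lambda>n. _ ^ n"] cong: if_cong)

section \<open>Pointwise decay of test functions\<close>

lemma cmod_mi_D: "cmod (mi_D \<beta> f x) = cmod (mi_deriv \<beta> f x)"
  unfolding mi_D_def by (simp add: norm_mult norm_power)

text \<open>Real form of the supremum. Finiteness is what keeps \<open>enn2real\<close> from sending
  an infinite seminorm to 0.\<close>

lemma gs_seminorm_bound:
  assumes fin: "gs_seminorm t s h f < \<infinity>" and "h > 0"
  shows "\<bar>mi_pow x \<alpha>\<bar> * cmod (mi_deriv \<beta> f x) \<le>
           enn2real (gs_seminorm t s h f) * h ^ (mi_abs \<alpha> + mi_abs \<beta>) * mi_fact \<alpha> powr t * mi_fact \<beta> powr s"
proof -
  let ?q = "h ^ (mi_abs \<alpha> + mi_abs \<beta>) * mi_fact \<alpha> powr t * mi_fact \<beta> powr s"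
  have q: "?q > 0"
    using assms(2) by (intro mult_pos_pos zero_less_power) auto
  have "ennreal (cmod (of_real (mi_pow x \<alpha>) * mi_D \<beta> f x) / ?q) \<le> gs_seminorm t s h f"
    unfolding gs_seminorm_def by (rule SUP_upper2[of "(\<alpha>, \<beta>, x)"]) auto
  hence "cmod (of_real (mi_pow x \<alpha>) * mi_D \<beta> f x) / ?q \<le> enn2real (gs_seminorm t s h f)"
    using enn2real_mono[of "ennreal _"] fin q by (fastforce simp: infinity_ennreal_def)
  thus ?thesis
    using q by (simp add: norm_mult cmod_mi_D pos_divide_le_eq mult_ac)
qed

lemma gs_spaceD:
  assumes "f \<in> gs_space t s"
  shows "smooth f" "h > 0 \<Longrightarrow> gs_seminorm t s h f < \<infinity>"
  using assms unfolding gs_space_def by auto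

text \<open>The seminorm with \<open>\<alpha>\<close> concentrated on one coordinate supplies the
  moments of each derivative. As \<open>h'\<close> and \<open>K\<close> are chosen before
  \<open>f\<close>, the estimate serves both for the decay of a fixed window and for the continuity
  of functionals.\<close>

lemma gs_space_exp_decay:
  assumes "t > 0" "A > 0" "h > 0"
  obtains h' K where "h' > 0" "h' \<le> h" "K \<ge> 0"
    "\<And>(f :: real ^ 'd::finite \<Rightarrow> complex) \<beta> x. f \<in> gs_space t s \<Longrightarrow>
       cmod (mi_deriv \<beta> f x) \<le>
         K * enn2real (gs_seminorm t s h' f) * h ^ mi_abs \<beta> * mi_fact \<beta> powr s * exp (- (A * gs_weight t x))"
proof -
  obtain h' where h': "h' > 0" "h' \<le> h"
    and decay: "\<And>(x :: real ^ 'd) v C. v \<ge> 0 \<Longrightarrow> C \<ge> 0 \<Longrightarrow>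
        (\<And>i n. \<bar>x $ i\<bar> ^ n * v \<le> C * h' ^ n * fact n powr t) \<Longrightarrow>
        v \<le> 2 powr t * C * exp (- (A * gs_weight t x))"
    using moments_imp_weight_decay[OF assms] by blast
  show ?thesis
  proof (rule that[of h' "2 powr t"])
    fix f :: "real ^ 'd \<Rightarrow> complex" and \<beta> :: "'d multiindex" and x :: "real ^ 'd"
    assume f: "f \<in> gs_space t s"
    let ?S = "enn2real (gs_seminorm t s h' f)"
    let ?B = "?S * h' ^ mi_abs \<beta> * mi_fact \<beta> powr s"
    have "\<bar>x $ i\<bar> ^ n * cmod (mi_deriv \<beta> f x) \<le> ?B * h' ^ n * fact n powr t" for i n
      using gs_seminorm_bound[OF gs_spaceD(2)[OF f h'(1)] h'(1), of x "mi_single i n" \<beta>]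
      by (simp add: power_add mult_ac power_abs)
    hence "cmod (mi_deriv \<beta> f x) \<le> 2 powr t * ?B * exp (- (A * gs_weight t x))"
      using h' by (intro decay) auto
    also have "\<dots> \<le> 2 powr t * (?S * h ^ mi_abs \<beta> * mi_fact \<beta> powr s) * exp (- (A * gs_weight t x))"
      using h' by (intro mult_left_mono mult_right_mono power_mono) auto
    finally show "cmod (mi_deriv \<beta> f x) \<le>
        2 powr t * ?S * h ^ mi_abs \<beta> * mi_fact \<beta> powr s * exp (- (A * gs_weight t x))"
      by (simp add: mult_ac)
  qed (use h' in auto)
qed

section \<open>Calculus of smooth functions\<close>

lemma has_derivative_partial_deriv:
  assumes "(f has_derivative f') (at x)"
  shows "partial_deriv i f x = f' (axis i 1)"
  unfolding partial_deriv_def using frechet_derivative_at[OF assms] by simp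

lemma partial_deriv_has_vector_derivative:
  assumes "f differentiable (at (x + \<theta> *\<^sub>R axis i 1))"
  shows "((\<lambda>\<theta>. f (x + \<theta> *\<^sub>R axis i 1)) has_vector_derivative
          partial_deriv i f (x + \<theta> *\<^sub>R axis i 1)) (at \<theta>)"
proof -
  let ?f' = "frechet_derivative f (at (x + \<theta> *\<^sub>R axis i 1))"
  have f': "(f has_derivative ?f') (at (x + \<theta> *\<^sub>R axis i 1))"
    using assms frechet_derivative_works by blast
  have "((\<lambda>\<theta>. x + \<theta> *\<^sub>R axis i 1) has_derivative (\<lambda>\<theta>. \<theta> *\<^sub>R axis i 1)) (at \<theta>)"
    by (auto intro!: derivative_eq_intros)
  from diff_chain_at[OF this f']
  have "((\<lambda>\<theta>. f (x + \<theta> *\<^sub>R axis i 1)) has_derivative (\<lambda>\<theta>. ?f' (\<theta> *\<^sub>R axis i 1))) (at \<theta>)"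
    by (simp add: o_def)
  thus ?thesis
    using linear_cmul[OF has_derivative_linear[OF f']]
    by (simp add: has_vector_derivative_def partial_deriv_def)
qed

lemma partial_deriv_lincomb:
  assumes "f differentiable (at x)" "g differentiable (at x)"
  shows "partial_deriv i (\<lambda>x. a * f x + b * g x) x = a * partial_deriv i f x + b * partial_deriv i g x"
proof -
  have "((\<lambda>x. a * f x + b * g x) has_derivative
         (\<lambda>v. a * frechet_derivative f (at x) v + b * frechet_derivative g (at x) v)) (at x)"
    using assms[THEN frechet_derivative_works[THEN iffD1]]
    by (intro has_derivative_add has_derivative_mult_right)
  from has_derivative_partial_deriv[OF this] show ?thesis
    by (simp add: partial_deriv_def)
qed

lemma smooth_differentiable:
  assumes "smooth f"
  shows "f differentiable (at x)"
  using assms[unfolded smooth_def, rule_format, of "[]" x] by simp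

lemma smooth_partial_deriv:
  assumes "smooth f"
  shows "smooth (partial_deriv i f)"
  unfolding smooth_def
proof (intro allI)
  fix "is" x
  show "foldr partial_deriv is (partial_deriv i f) differentiable (at x)"
    using assms[unfolded smooth_def, rule_format, of "is @ [i]" x] by simp
qed

lemma smooth_partial_deriv_pow:
  assumes "smooth f"
  shows "smooth ((partial_deriv i ^^ n) f)"
  using assms by (induction n) (auto intro: smooth_partial_deriv)

lemma smooth_foldr_partial_deriv_pow:
  assumes "smooth f"
  shows "smooth (foldr (\<lambda>i. partial_deriv i ^^ \<beta> i) L f)"
  using assms by (induction L) (auto intro: smooth_partial_deriv_pow)

lemma smooth_continuous_on:
  assumes "smooth f"
  shows "continuous_on S f"
  using smooth_differentiable[OF assms]
  by (meson continuous_at_imp_continuous_on differentiable_imp_continuous_within)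

text \<open>Smoothness is the largest property that implies differentiability and survives partial
  derivatives. Closure properties thus follow by exhibiting an invariant class, without formulas for
  higher derivatives.\<close>

lemma smooth_coinduct:
  assumes "P f"
    and diff: "\<And>g x. P g \<Longrightarrow> g differentiable (at x)"
    and step: "\<And>g i. P g \<Longrightarrow> P (partial_deriv i g)"
  shows "smooth f"
proof -
  have "P (foldr partial_deriv is f)" for "is"
    by (induction "is") (auto intro: assms)
  thus ?thesis
    unfolding smooth_def by (intro allI diff)
qed

lemma partial_deriv_smooth_lincomb:
  assumes "smooth f" "smooth g"
  shows "partial_deriv i (\<lambda>x. a * f x + b * g x) =
         (\<lambda>x. a * partial_deriv i f x + b * partial_deriv i g x)"
  using assms by (intro ext partial_deriv_lincomb smooth_differentiable)

lemma smooth_lincomb: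
  assumes "smooth f" "smooth g"
  shows "smooth (\<lambda>x. a * f x + b * g x)"
proof (rule smooth_coinduct[of "\<lambda>h. \<exists>f g. smooth f \<and> smooth g \<and> h = (\<lambda>x. a * f x + b * g x)"])
  show "\<exists>f' g'. smooth f' \<and> smooth g' \<and> (\<lambda>x. a * f x + b * g x) = (\<lambda>x. a * f' x + b * g' x)"
    using assms by blast
next
  fix h x assume "\<exists>f g. smooth f \<and> smooth g \<and> h = (\<lambda>x. a * f x + b * g x)"
  thus "h differentiable (at x)"
    by (elim exE conjE)
       (simp only:, intro differentiable_add differentiable_mult differentiable_const smooth_differentiable)
next
  fix h i assume "\<exists>f g. smooth f \<and> smooth g \<and> h = (\<lambda>x. a * f x + b * g x)"
  thus "\<exists>f g. smooth f \<and> smooth g \<and> partial_deriv i h = (\<lambda>x. a * f x + b * g x)"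
    using partial_deriv_smooth_lincomb smooth_partial_deriv by blast
qed

lemma partial_deriv_pow_lincomb:
  assumes "smooth f" "smooth g"
  shows "(partial_deriv i ^^ n) (\<lambda>x. a * f x + b * g x) =
         (\<lambda>x. a * (partial_deriv i ^^ n) f x + b * (partial_deriv i ^^ n) g x)"
  using assms
  by (induction n) (auto simp: partial_deriv_smooth_lincomb smooth_partial_deriv_pow)

lemma foldr_partial_deriv_pow_lincomb:
  assumes "smooth f" "smooth g"
  shows "foldr (\<lambda>i. partial_deriv i ^^ \<beta> i) L (\<lambda>x. a * f x + b * g x) =
         (\<lambda>x. a * foldr (\<lambda>i. partial_deriv i ^^ \<beta> i) L f x + b * foldr (\<lambda>i. partial_deriv i ^^ \<beta> i) L g x)"
  using assms
  by (induction L) (auto simp: partial_deriv_pow_lincomb smooth_foldr_partial_deriv_pow)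

lemma mi_deriv_lincomb:
  assumes "smooth f" "smooth g"
  shows "mi_deriv \<beta> (\<lambda>x. a * f x + b * g x) = (\<lambda>x. a * mi_deriv \<beta> f x + b * mi_deriv \<beta> g x)"
  unfolding mi_deriv_def by (rule foldr_partial_deriv_pow_lincomb[OF assms])

lemma mi_D_lincomb:
  assumes "smooth f" "smooth g"
  shows "mi_D \<beta> (\<lambda>x. a * f x + b * g x) = (\<lambda>x. a * mi_D \<beta> f x + b * mi_D \<beta> g x)"
  unfolding mi_D_def by (simp add: mi_deriv_lincomb[OF assms] algebra_simps)

lemma smooth_zero: "smooth (\<lambda>x. 0)"
  by (rule smooth_coinduct[of "\<lambda>f. f = (\<lambda>x. 0)"]) (auto simp: partial_deriv_def)

lemma smooth_sum:
  assumes "\<And>k. k \<in> K \<Longrightarrow> smooth (f k)"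
  shows "smooth (\<lambda>x. \<Sum>k\<in>K. a k * f k x)"
  using assms
proof (induction K rule: infinite_finite_induct)
  case (insert k K)
  thus ?case
    using smooth_lincomb[of "f k" "\<lambda>x. \<Sum>k\<in>K. a k * f k x" "a k" 1] by simp
qed (auto intro: smooth_zero)

lemma foldr_partial_deriv_pow_sum:
  assumes "\<And>k. k \<in> K \<Longrightarrow> smooth (f k)" "finite K"
  shows "foldr (\<lambda>i. partial_deriv i ^^ \<beta> i) L (\<lambda>x. \<Sum>k\<in>K. a k * f k x) =
         (\<lambda>x. \<Sum>k\<in>K. a k * foldr (\<lambda>i. partial_deriv i ^^ \<beta> i) L (f k) x)"
  using assms(2,1)
proof (induction K rule: finite_induct)
  case empty
  show ?case
    using foldr_partial_deriv_pow_lincomb[OF smooth_zero smooth_zero, of \<beta> L 0 0] by simp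
next
  case (insert k K)
  thus ?case
    using foldr_partial_deriv_pow_lincomb[of "f k" "\<lambda>x. \<Sum>k\<in>K. a k * f k x" \<beta> L "a k" 1] smooth_sum[of K f a]
    by simp
qed

section \<open>Translations and modulations\<close>

lemma has_derivative_translate:
  assumes "(g has_derivative g') (at (y - x))"
  shows "(translate x g has_derivative g') (at y)"
proof -
  have "((\<lambda>y. y - x) has_derivative (\<lambda>y. y)) (at y)"
    by (auto intro!: derivative_eq_intros)
  from diff_chain_at[OF this assms] show ?thesis
    by (simp add: o_def translate_def)
qed

lemma partial_deriv_translate:
  assumes "smooth g"
  shows "partial_deriv i (translate x g) = translate x (partial_deriv i g)"
proof
  fix y
  have "(g has_derivative frechet_derivative g (at (y - x))) (at (y - x))"
    using smooth_differentiable[OF assms] frechet_derivative_works by blast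
  from has_derivative_partial_deriv[OF has_derivative_translate[OF this]]
  show "partial_deriv i (translate x g) y = translate x (partial_deriv i g) y"
    by (simp add: translate_def partial_deriv_def)
qed

lemma smooth_translate:
  assumes "smooth g"
  shows "smooth (translate x g)"
proof (rule smooth_coinduct[of "\<lambda>h. \<exists>g. smooth g \<and> h = translate x g"])
  show "\<exists>g'. smooth g' \<and> translate x g = translate x g'"
    using assms by blast
next
  fix h y assume "\<exists>g. smooth g \<and> h = translate x g"
  thus "h differentiable (at y)"
    using has_derivative_translate smooth_differentiable unfolding differentiable_def by blast
next
  fix h i assume "\<exists>g. smooth g \<and> h = translate x g"
  thus "\<exists>g. smooth g \<and> partial_deriv i h = translate x g"
    using partial_deriv_translate smooth_partial_deriv by blast
qed

lemma partial_deriv_pow_translate: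
  assumes "smooth g"
  shows "(partial_deriv i ^^ n) (translate x g) = translate x ((partial_deriv i ^^ n) g)"
  using assms
  by (induction n) (auto simp: partial_deriv_translate smooth_partial_deriv_pow)

lemma mi_deriv_translate:
  assumes "smooth g"
  shows "mi_deriv \<beta> (translate x g) = translate x (mi_deriv \<beta> g)"
proof -
  have "foldr (\<lambda>i. partial_deriv i ^^ \<beta> i) L (translate x g) =
        translate x (foldr (\<lambda>i. partial_deriv i ^^ \<beta> i) L g)" for L
    using assms
    by (induction L) (auto simp: partial_deriv_pow_translate smooth_foldr_partial_deriv_pow)
  thus ?thesis
    unfolding mi_deriv_def .
qed

lemma has_derivative_modulate:
  assumes "(g has_derivative g') (at y)"
  shows "(modulate \<xi> g has_derivative
          (\<lambda>v. exp (\<i> * of_real (y \<bullet> \<xi>)) * (\<i> * of_real (v \<bullet> \<xi>) * g y + g' v))) (at y)"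
proof -
  have "((\<lambda>y. \<i> * complex_of_real (y \<bullet> \<xi>)) has_derivative (\<lambda>v. \<i> * of_real (v \<bullet> \<xi>))) (at y)"
    by (auto intro!: derivative_eq_intros)
  moreover have "(exp has_derivative (\<lambda>v. exp (\<i> * of_real (y \<bullet> \<xi>)) * v)) (at (\<i> * complex_of_real (y \<bullet> \<xi>)))"
    using DERIV_exp unfolding has_field_derivative_def .
  ultimately have "((\<lambda>y. exp (\<i> * of_real (y \<bullet> \<xi>))) has_derivative
      (\<lambda>v. exp (\<i> * of_real (y \<bullet> \<xi>)) * (\<i> * of_real (v \<bullet> \<xi>)))) (at y)"
    using diff_chain_at by (fastforce simp: o_def)
  from has_derivative_mult[OF this assms] show ?thesis
    unfolding modulate_def by (simp add: algebra_simps)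
qed

text \<open>Modulation conjugates the derivative into itself plus the scalar i \<xi>_i. The explicit
  coefficient \<open>1\<close> keeps the bracket in the shape of \<open>smooth_lincomb\<close> and
  \<open>partial_deriv_pow_lincomb\<close>.\<close>

lemma partial_deriv_modulate:
  assumes "smooth g"
  shows "partial_deriv i (modulate \<xi> g) = modulate \<xi> (\<lambda>y. \<i> * of_real (\<xi> $ i) * g y + 1 * partial_deriv i g y)"
proof
  fix y
  have "(g has_derivative frechet_derivative g (at y)) (at y)"
    using smooth_differentiable[OF assms] frechet_derivative_works by blast
  from has_derivative_partial_deriv[OF has_derivative_modulate[OF this]]
  show "partial_deriv i (modulate \<xi> g) y = modulate \<xi> (\<lambda>y. \<i> * of_real (\<xi> $ i) * g y + 1 * partial_deriv i g y) y"
    by (simp add: modulate_def partial_deriv_def inner_axis' )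
qed

lemma smooth_modulate:
  assumes "smooth g"
  shows "smooth (modulate \<xi> g)"
proof (rule smooth_coinduct[of "\<lambda>h. \<exists>g. smooth g \<and> h = modulate \<xi> g"])
  show "\<exists>g'. smooth g' \<and> modulate \<xi> g = modulate \<xi> g'"
    using assms by blast
next
  fix h y assume "\<exists>g. smooth g \<and> h = modulate \<xi> g"
  thus "h differentiable (at y)"
    using has_derivative_modulate smooth_differentiable unfolding differentiable_def by blast
next
  fix h i assume "\<exists>g. smooth g \<and> h = modulate \<xi> g"
  thus "\<exists>g. smooth g \<and> partial_deriv i h = modulate \<xi> g"
    using partial_deriv_modulate smooth_partial_deriv smooth_lincomb by blast
qed

lemma coords_props: "distinct (coords :: 'd::finite list)" "set (coords :: 'd list) = UNIV"
proof -
  have "\<exists>is :: 'd list. distinct is \<and> set is = UNIV"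
    using finite_distinct_list[of "UNIV :: 'd set"] by auto
  thus "distinct (coords :: 'd list)" "set (coords :: 'd list) = UNIV"
    unfolding coords_def by (metis (mono_tags, lifting) someI_ex)+
qed

lemma mi_deriv_single: "mi_deriv (mi_single i n) f = (partial_deriv i ^^ n) f"
proof -
  have *: "foldr (\<lambda>j. partial_deriv j ^^ mi_single i n j) L f =
          (if i \<in> set L then (partial_deriv i ^^ n) f else f)" if "distinct L" for L
    using that by (induction L) (auto simp: mi_single_def)
  show ?thesis
    unfolding mi_deriv_def by (subst *) (auto simp: coords_props)
qed

section \<open>Functionals on Gelfand--Shilov spaces\<close>

lemma gs_seminorm_lincomb_finite:
  fixes f g :: "real ^ 'd::finite \<Rightarrow> complex"
  assumes f: "f \<in> gs_space t s" and g: "g \<in> gs_space t s" and "h > 0"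
  shows "gs_seminorm t s h (\<lambda>x. a * f x + b * g x) < \<infinity>"
proof -
  let ?S = "\<lambda>f. enn2real (gs_seminorm t s h f)"
  have "gs_seminorm t s h (\<lambda>x. a * f x + b * g x) \<le> ennreal (cmod a * ?S f + cmod b * ?S g)"
    unfolding gs_seminorm_def[of t s h "\<lambda>x. a * f x + b * g x"]
  proof (rule SUP_least, clarify)
    fix \<alpha> \<beta> :: "'d multiindex" and x :: "real ^ 'd"
    let ?q = "h ^ (mi_abs \<alpha> + mi_abs \<beta>) * mi_fact \<alpha> powr t * mi_fact \<beta> powr s"
    have q: "?q > 0"
      using \<open>h > 0\<close> by (intro mult_pos_pos zero_less_power) auto
    have bound: "\<bar>mi_pow x \<alpha>\<bar> * cmod (mi_deriv \<beta> k x) \<le> ?S k * ?q" if "k \<in> gs_space t s" for k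
      using gs_seminorm_bound[OF gs_spaceD(2)[OF that \<open>h > 0\<close>] \<open>h > 0\<close>, of x \<alpha> \<beta>]
      by (simp add: mult_ac)
    have "cmod (of_real (mi_pow x \<alpha>) * mi_D \<beta> (\<lambda>x. a * f x + b * g x) x)
        = \<bar>mi_pow x \<alpha>\<bar> * cmod (a * mi_deriv \<beta> f x + b * mi_deriv \<beta> g x)"
      using f g by (simp add: norm_mult cmod_mi_D mi_deriv_lincomb gs_spaceD(1))
    also have "\<dots> \<le> \<bar>mi_pow x \<alpha>\<bar> * (cmod a * cmod (mi_deriv \<beta> f x) + cmod b * cmod (mi_deriv \<beta> g x))"
      by (intro mult_left_mono order_trans[OF norm_triangle_ineq]) (auto simp: norm_mult)
    also have "\<dots> = cmod a * (\<bar>mi_pow x \<alpha>\<bar> * cmod (mi_deriv \<beta> f x)) +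
                    cmod b * (\<bar>mi_pow x \<alpha>\<bar> * cmod (mi_deriv \<beta> g x))"
      by (simp add: algebra_simps)
    also have "\<dots> \<le> cmod a * (?S f * ?q) + cmod b * (?S g * ?q)"
      using bound[OF f] bound[OF g] by (intro add_mono mult_left_mono) auto
    also have "\<dots> = (cmod a * ?S f + cmod b * ?S g) * ?q"
      by (simp add: algebra_simps)
    finally show "ennreal (cmod (of_real (mi_pow x \<alpha>) * mi_D \<beta> (\<lambda>x. a * f x + b * g x) x) / ?q)
        \<le> ennreal (cmod a * ?S f + cmod b * ?S g)"
      using q by (intro ennreal_leI) (simp only: pos_divide_le_eq)
  qed
  thus ?thesis
    by (rule le_less_trans) simp
qed

lemma gs_space_lincomb:
  assumes "f \<in> gs_space t s" "g \<in> gs_space t s"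
  shows "(\<lambda>x. a * f x + b * g x) \<in> gs_space t s"
  using gs_seminorm_lincomb_finite[OF assms] smooth_lincomb[OF assms[THEN gs_spaceD(1)]]
  unfolding gs_space_def by auto

lemma gs_seminorm_zero [simp]: "gs_seminorm t s h (\<lambda>x. 0) = 0"
proof -
  have "mi_deriv \<beta> (\<lambda>x. 0) = (\<lambda>x. 0 :: complex)" for \<beta> :: "'a multiindex"
    using mi_deriv_lincomb[OF smooth_zero smooth_zero, of \<beta> 0 0] by simp
  thus ?thesis
    unfolding gs_seminorm_def mi_D_def by (simp add: case_prod_beta)
qed

lemma gs_ball_centre:
  assumes "f \<in> gs_space t s" "\<epsilon> > 0"
  shows "f \<in> gs_ball t s f h \<epsilon>"
  unfolding gs_ball_def using assms by simp

lemma openin_gs_ball: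
  assumes "f \<in> gs_space t s" "h > 0" "\<epsilon> > 0"
  shows "openin (gs_topology t s) (gs_ball t s f h \<epsilon>)"
  unfolding gs_topology_def using assms by (intro topology_generated_by_Basis) blast

lemma topspace_gs_topology: "topspace (gs_topology t s) = gs_space t s"
proof
  show "topspace (gs_topology t s) \<subseteq> gs_space t s"
    unfolding gs_topology_def topology_generated_by_topspace gs_ball_def by auto
  show "gs_space t s \<subseteq> topspace (gs_topology t s)"
    using gs_ball_centre[of _ t s 1 1] openin_subset[OF openin_gs_ball[of _ t s 1 1]] by fastforce
qed

text \<open>Linearity turns the bound at 0 into a Lipschitz bound at every point, so a ball of this
  one seminorm is carried into any prescribed neighbourhood of the value.\<close>

lemma gs_dualI:
  fixes v :: "'d::finite functional"
  assumes "h > 0" "C \<ge> 0"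
    and lin: "\<And>\<phi> \<eta> a b. \<phi> \<in> gs_space t s \<Longrightarrow> \<eta> \<in> gs_space t s \<Longrightarrow>
               v (\<lambda>x. a * \<phi> x + b * \<eta> x) = cnj a * v \<phi> + cnj b * v \<eta>"
    and bound: "\<And>\<phi>. \<phi> \<in> gs_space t s \<Longrightarrow> cmod (v \<phi>) \<le> C * enn2real (gs_seminorm t s h \<phi>)"
  shows "v \<in> gs_dual t s"
proof -
  have "openin (gs_topology t s) {\<phi> \<in> gs_space t s. v \<phi> \<in> U}" if "open U" for U
  proof (subst openin_subopen, safe)
    fix \<phi> assume \<phi>: "\<phi> \<in> gs_space t s" "v \<phi> \<in> U"
    then obtain \<delta> where \<delta>: "\<delta> > 0" "\<And>z. dist z (v \<phi>) < \<delta> \<Longrightarrow> z \<in> U"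
      using \<open>open U\<close> unfolding open_dist by blast
    \<comment> \<open>\<open>C\<close> may vanish; with \<open>C + 1\<close> the quotient is defined
      and \<open>C * \<epsilon>\<close> stays strictly below \<open>\<delta>\<close>.\<close>
    define \<epsilon> where "\<epsilon> = \<delta> / (C + 1)"
    have \<epsilon>: "\<epsilon> > 0" "C * \<epsilon> < \<delta>"
      using \<delta> \<open>C \<ge> 0\<close> by (auto simp: \<epsilon>_def field_simps)
    have "gs_ball t s \<phi> h \<epsilon> \<subseteq> {\<phi> \<in> gs_space t s. v \<phi> \<in> U}"
    proof
      fix g assume "g \<in> gs_ball t s \<phi> h \<epsilon>"
      hence g: "g \<in> gs_space t s" "gs_seminorm t s h (\<lambda>x. g x - \<phi> x) < ennreal \<epsilon>"
        unfolding gs_ball_def by auto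
      have diff: "(\<lambda>x. g x - \<phi> x) = (\<lambda>x. 1 * g x + (-1) * \<phi> x)"
        by simp
      have "dist (v g) (v \<phi>) = cmod (v (\<lambda>x. g x - \<phi> x))"
        unfolding diff lin[OF g(1) \<phi>(1)] by (simp add: dist_norm)
      also have "\<dots> \<le> C * enn2real (gs_seminorm t s h (\<lambda>x. g x - \<phi> x))"
        unfolding diff by (intro bound gs_space_lincomb g \<phi>)
      also have "\<dots> \<le> C * \<epsilon>"
        using g(2) \<epsilon> \<open>C \<ge> 0\<close> by (intro mult_left_mono enn2real_leI) auto
      finally show "g \<in> {\<phi> \<in> gs_space t s. v \<phi> \<in> U}"
        using g \<epsilon> \<delta> by simp
    qed
    thus "\<exists>T. openin (gs_topology t s) T \<and> \<phi> \<in> T \<and> T \<subseteq> {\<phi> \<in> gs_space t s. v \<phi> \<in> U}"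
      using openin_gs_ball[OF \<phi>(1) \<open>h > 0\<close> \<epsilon>(1)] gs_ball_centre[OF \<phi>(1) \<epsilon>(1)] by blast
  qed
  thus ?thesis
    using lin unfolding gs_dual_def continuous_map topspace_gs_topology by auto
qed

section \<open>Integration\<close>

text \<open>Extension by 0 off the range of \<open>to_nat\<close> covers finite and infinite index
  types alike and opens the way to theorems about ordinary series.\<close>

lemma has_sum_to_nat_iff:
  fixes F :: "'i::countable \<Rightarrow> 'a::{comm_monoid_add, topological_space}"
  shows "(F has_sum S) UNIV \<longleftrightarrow>
         ((\<lambda>n. if n \<in> range (to_nat :: 'i \<Rightarrow> nat) then F (from_nat n) else 0) has_sum S) UNIV"
proof -
  let ?G = "\<lambda>n. if n \<in> range (to_nat :: 'i \<Rightarrow> nat) then F (from_nat n) else 0"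
  have "(?G has_sum S) UNIV \<longleftrightarrow> (?G has_sum S) (range (to_nat :: 'i \<Rightarrow> nat))"
    by (intro has_sum_cong_neutral) auto
  also have "\<dots> \<longleftrightarrow> (?G \<circ> (to_nat :: 'i \<Rightarrow> nat) has_sum S) UNIV"
    by (intro has_sum_reindex) auto
  also have "?G \<circ> (to_nat :: 'i \<Rightarrow> nat) = F"
    by (auto simp: fun_eq_iff)
  finally show ?thesis ..
qed

text \<open>The majorant separates the variables, so the integrals of the norms add up to at most
  the sum of \<open>b\<close> times the integral of \<open>w\<close>; this licenses interchanging
  sum and integral.\<close>

lemma
  fixes F :: "'i::countable \<Rightarrow> 'a \<Rightarrow> 'b::{banach, second_countable_topology}"
  assumes [measurable]: "\<And>\<alpha>. F \<alpha> \<in> borel_measurable M"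
    and bound: "\<And>\<alpha> x. norm (F \<alpha> x) \<le> b \<alpha> * w x"
    and b: "b summable_on UNIV" and w: "integrable M w"
  shows integrable_infsum_dominated: "integrable M (\<lambda>x. \<Sum>\<^sub>\<infinity>\<alpha>. F \<alpha> x)"
    and has_sum_integral_dominated:
      "((\<lambda>\<alpha>. \<integral>x. F \<alpha> x \<partial>M) has_sum (\<integral>x. (\<Sum>\<^sub>\<infinity>\<alpha>. F \<alpha> x) \<partial>M)) UNIV"
proof -
  let ?R = "range (to_nat :: 'i \<Rightarrow> nat)"
  define b' where "b' n = (if n \<in> ?R then b (from_nat n) else 0)" for n
  define F' where "F' n x = (if n \<in> ?R then F (from_nat n) x else 0)" for n x
  have integrable_F: "integrable M (F \<alpha>)" for \<alpha>
  proof (rule Bochner_Integration.integrable_bound)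
    show "integrable M (\<lambda>x. b \<alpha> * w x)"
      using w by simp
    show "AE x in M. norm (F \<alpha> x) \<le> norm (b \<alpha> * w x)"
      using bound by (intro always_eventually allI order_trans[OF bound]) auto
  qed simp
  have integrable_F': "integrable M (F' n)" for n
    unfolding F'_def using integrable_F by (cases "n \<in> ?R") auto
  have "(b' has_sum infsum b UNIV) UNIV"
    using b has_sum_to_nat_iff[of b "infsum b UNIV"] unfolding b'_def by simp
  hence b': "summable b'"
    by (rule sums_summable[OF has_sum_imp_sums])
  have bound': "norm (F' n x) \<le> b' n * w x" for n x
    using bound by (auto simp: F'_def b'_def)
  have summable': "summable (\<lambda>n. norm (F' n x))" for x
    using bound' by (intro summable_comparison_test[OF _ summable_mult2[OF b', of "w x"]]) auto
  have infsum_eq: "(\<Sum>\<^sub>\<infinity>\<alpha>. F \<alpha> x) = (\<Sum>n. F' n x)" for x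
  proof -
    have "(F' n x) = (if n \<in> ?R then F (from_nat n) x else 0)" for n
      by (simp add: F'_def)
    moreover have "((\<lambda>n. F' n x) has_sum (\<Sum>n. F' n x)) UNIV"
      by (intro norm_summable_imp_has_sum[OF summable'] summable_sums summable_norm_cancel[OF summable'])
    ultimately show ?thesis
      using has_sum_to_nat_iff[of "\<lambda>\<alpha>. F \<alpha> x"] by (intro infsumI) simp
  qed
  have summable_int: "summable (\<lambda>n. \<integral>x. norm (F' n x) \<partial>M)"
  proof (rule summable_comparison_test[OF _ summable_mult2[OF b', of "integral\<^sup>L M w"]], intro exI allI impI)
    fix n
    have "(\<integral>x. norm (F' n x) \<partial>M) \<le> (\<integral>x. b' n * w x \<partial>M)"
      using bound' integrable_F' w by (intro integral_mono) auto
    thus "norm (\<integral>x. norm (F' n x) \<partial>M) \<le> b' n * integral\<^sup>L M w"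
      by simp
  qed
  show "integrable M (\<lambda>x. \<Sum>\<^sub>\<infinity>\<alpha>. F \<alpha> x)"
    unfolding infsum_eq using integrable_F' summable' summable_int by (intro integrable_suminf) auto
  have "(\<lambda>n. integral\<^sup>L M (F' n)) sums (\<integral>x. (\<Sum>n. F' n x) \<partial>M)"
    using integrable_F' summable' summable_int by (intro sums_integral) auto
  \<comment> \<open>Absolute convergence upgrades the ordered \<open>sums\<close> to the unordered
    \<open>has_sum\<close>.\<close>
  moreover have "summable (\<lambda>n. norm (integral\<^sup>L M (F' n)))"
    by (rule summable_comparison_test[OF _ summable_int]) auto
  ultimately have "((\<lambda>n. integral\<^sup>L M (F' n)) has_sum (\<integral>x. (\<Sum>n. F' n x) \<partial>M)) UNIV"
    by (intro norm_summable_imp_has_sum)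
  also have "(\<lambda>n. integral\<^sup>L M (F' n)) = (\<lambda>n. if n \<in> ?R then integral\<^sup>L M (F (from_nat n)) else 0)"
    by (auto simp: fun_eq_iff F'_def[abs_def])
  finally show "((\<lambda>\<alpha>. \<integral>x. F \<alpha> x \<partial>M) has_sum (\<integral>x. (\<Sum>\<^sub>\<infinity>\<alpha>. F \<alpha> x) \<partial>M)) UNIV"
    unfolding infsum_eq by (subst has_sum_to_nat_iff)
qed

section \<open>Integrability of the exponential weight\<close>

lemma powr_le_const_exp:
  fixes p :: real
  assumes "p \<ge> 0"
  obtains C where "C > 0" "\<And>a. a \<ge> 0 \<Longrightarrow> a powr p \<le> C * exp a"
proof (rule that[of "fact (nat \<lceil>p\<rceil>)"])
  fix a :: real assume a: "a \<ge> 0"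
  let ?N = "nat \<lceil>p\<rceil>"
  show "a powr p \<le> fact ?N * exp a"
  \<comment> \<open>Rounding the exponent up enlarges the power only for bases at least 1; for
    smaller \<open>a\<close> both sides are compared with 1.\<close>
  proof (cases "a \<le> 1")
    case True
    hence "a powr p \<le> 1"
      using a assms by (intro powr_le1) auto
    also have "1 \<le> fact ?N * exp a"
      using a mult_mono[of 1 "fact ?N" 1 "exp a"] by (simp add: fact_ge_1)
    finally show ?thesis .
  next
    case False
    hence "a powr p \<le> a powr real ?N"
      using assms by (intro powr_mono) auto
    also have "\<dots> = a ^ ?N"
      using False by (simp add: powr_realpow)
    also have "\<dots> \<le> fact ?N * exp a"
      using power_le_fact_powr_exp[of a 1 ?N] False by simp
    finally show ?thesis .
  qed
qed auto

text \<open>Comparison with \<open>inverse (1 + y\<^sup>2)\<close>: the square of y is the power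
  \<open>2 / p\<close> of \<open>\<bar>y\<bar> powr p\<close>, hence at most a constant times the
  exponential of the latter.\<close>

lemma integrable_exp_minus_powr:
  fixes p :: real
  assumes "p > 0"
  shows "integrable lborel (\<lambda>y::real. exp (- (\<bar>y\<bar> powr p)))"
proof -
  obtain C where C: "C > 0" "\<And>a. a \<ge> 0 \<Longrightarrow> a powr (2 / p) \<le> C * exp a"
    using powr_le_const_exp[of "2 / p"] assms by auto
  have "integrable lborel (\<lambda>y::real. inverse (1 + y\<^sup>2))"
    using integrable_inverse_1_plus_square by (simp add: set_integrable_def)
  hence int: "integrable lborel (\<lambda>y::real. (1 + C) * inverse (1 + y\<^sup>2))"
    by simp
  show ?thesis
  proof (rule Bochner_Integration.integrable_bound[OF int])
    show "AE y in lborel. norm (exp (- (\<bar>y\<bar> powr p))) \<le> norm ((1 + C) * inverse (1 + y\<^sup>2))"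
    proof (intro always_eventually allI)
      fix y :: real
      let ?a = "\<bar>y\<bar> powr p"
      have "y\<^sup>2 = ?a powr (2 / p)"
        using assms by (simp add: powr_powr)
      also have "\<dots> \<le> C * exp ?a"
        by (rule C) simp
      finally have "1 + y\<^sup>2 \<le> (1 + C) * exp ?a"
        by (simp add: algebra_simps add_mono)
      moreover have "1 + y\<^sup>2 > 0"
        by (simp add: add_pos_nonneg)
      ultimately have "exp (- ?a) \<le> (1 + C) * inverse (1 + y\<^sup>2)"
        by (simp add: exp_minus field_simps)
      thus "norm (exp (- ?a)) \<le> norm ((1 + C) * inverse (1 + y\<^sup>2))"
        by simp
    qed
  qed simp
qed

text \<open>\<open>lborel\<close> is an image of the product measure indexed by
  \<open>Basis\<close>; in this form the exponential of the weight factorises over that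
  product.\<close>

lemma gs_weight_Basis:
  "gs_weight s x = (\<Sum>b\<in>Basis. \<bar>x \<bullet> b\<bar> powr (1/s))" for x :: "real ^ 'd::finite"
proof -
  have "(\<Sum>b\<in>Basis. \<bar>x \<bullet> b\<bar> powr (1/s)) = (\<Sum>b\<in>range (\<lambda>i. axis i 1). \<bar>x \<bullet> b\<bar> powr (1/s))"
    by (rule sum.cong) (auto simp: Basis_vec_def)
  also have "\<dots> = (\<Sum>i\<in>UNIV. \<bar>x \<bullet> axis i 1\<bar> powr (1/s))"
    by (subst sum.reindex) (auto intro!: injI simp: axis_eq_axis)
  finally show ?thesis
    by (simp add: gs_weight_def cart_eq_inner_axis)
qed

lemma borel_measurable_gs_weight [measurable]:
  "gs_weight s \<in> borel_measurable (borel :: (real ^ 'd::finite) measure)"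
  unfolding gs_weight_Basis[abs_def] by measurable

lemma integrable_exp_minus_gs_weight:
  assumes "s > 0"
  shows "integrable lborel (\<lambda>y :: real ^ 'd::finite. exp (- gs_weight s y))"
proof -
  interpret product_sigma_finite "\<lambda>b :: real ^ 'd. lborel :: real measure" ..
  have "exp (- gs_weight s (\<Sum>b\<in>Basis. f b *\<^sub>R b)) = (\<Prod>b\<in>Basis. exp (- (\<bar>f b\<bar> powr (1/s))))"
    for f :: "real ^ 'd \<Rightarrow> real"
    by (simp add: gs_weight_Basis exp_sum sum_negf[symmetric])
  hence "integrable (Pi\<^sub>M Basis (\<lambda>b :: real ^ 'd. lborel))
      (\<lambda>f. exp (- gs_weight s (\<Sum>b\<in>Basis. f b *\<^sub>R b)))"
    using assms by (simp, intro product_integrable_prod integrable_exp_minus_powr) auto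
  thus ?thesis
    by (subst lborel_eq, subst integrable_distr_eq) measurable
qed

lemma
  fixes g :: "'a::euclidean_space \<Rightarrow> 'b::{banach, second_countable_topology}"
  assumes [measurable]: "g \<in> borel_measurable borel"
  shows integrable_lborel_translate: "integrable lborel (\<lambda>y. g (y + c)) \<longleftrightarrow> integrable lborel g"
    and integral_lborel_translate: "(LINT y|lborel. g (y + c)) = (LINT y|lborel. g y)"
proof -
  show "integrable lborel (\<lambda>y. g (y + c)) \<longleftrightarrow> integrable lborel g"
    by (subst (2) lborel_distr_plus[of c, symmetric], subst integrable_distr_eq) (auto simp: add.commute)
  show "(LINT y|lborel. g (y + c)) = (LINT y|lborel. g y)"
    by (subst (2) lborel_distr_plus[of c, symmetric], subst integral_distr) (auto simp: add.commute)
qed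

text \<open>
  Average the derivative over the unit segment in direction \<open>i\<close>: by Fubini and translation invariance
  this does not change its integral, and it turns the integrand into a difference of translates.
\<close>

lemma integral_partial_deriv_eq_0:
  fixes G :: "real ^ 'd::finite \<Rightarrow> complex"
  assumes diff: "\<And>x. G differentiable (at x)"
    and cont: "continuous_on UNIV (partial_deriv i G)"
    and G: "integrable lborel G" and D: "integrable lborel (partial_deriv i G)"
  shows "(LINT y|lborel. partial_deriv i G y) = 0"
proof -
  let ?D = "partial_deriv i G" and ?e = "axis i 1 :: real ^ 'd"
  have [measurable]: "?D \<in> borel_measurable borel" "G \<in> borel_measurable borel"
    using cont D G by (auto intro: borel_measurable_continuous_onI)
  let ?F = "\<lambda>\<theta> y. indicator {0..1::real} \<theta> *\<^sub>R ?D (y + \<theta> *\<^sub>R ?e)"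
  have trans: "(LINT y|lborel. ?D (y + c)) = integral\<^sup>L lborel ?D"
    "(LINT y|lborel. norm (?D (y + c))) = (LINT y|lborel. norm (?D y))"
    "integrable lborel (\<lambda>y. ?D (y + c))" for c
    using D integral_lborel_translate[of ?D c] integral_lborel_translate[of "\<lambda>y. norm (?D y)" c]
    by (simp_all add: integrable_lborel_translate)
  have "integrable (lborel \<Otimes>\<^sub>M lborel) (case_prod ?F)"
    by (rule lborel_pair.Fubini_integrable) (auto simp: trans)
  note swap = lborel_pair.Fubini_integral[OF this]
  have inner: "(LINT \<theta>|lborel. ?F \<theta> y) = G (y + ?e) - G y" for y
  proof -
    have "has_bochner_integral lborel (\<lambda>\<theta>. ?F \<theta> y) (G (y + 1 *\<^sub>R ?e) - G (y + 0 *\<^sub>R ?e))"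
    proof (rule has_bochner_integral_FTC_Icc)
      show "((\<lambda>\<theta>. G (y + \<theta> *\<^sub>R ?e)) has_vector_derivative ?D (y + \<theta> *\<^sub>R ?e)) (at \<theta> within {0..1})" for \<theta>
        by (rule has_vector_derivative_at_within[OF partial_deriv_has_vector_derivative[OF diff]])
      show "continuous_on {0..1} (\<lambda>\<theta>. ?D (y + \<theta> *\<^sub>R ?e))"
        by (intro continuous_on_compose2[OF cont] continuous_intros) auto
    qed simp
    thus ?thesis
      by (simp add: has_bochner_integral_iff)
  qed
  have "integral\<^sup>L lborel ?D = (LINT \<theta>|lborel. LINT y|lborel. ?F \<theta> y)"
    by (simp add: trans)
  also have "\<dots> = (LINT y|lborel. G (y + ?e) - G y)"
    by (simp only: swap[symmetric] inner)
  also have "\<dots> = 0"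
    using G by (simp add: integrable_lborel_translate integral_lborel_translate)
  finally show ?thesis .
qed

section \<open>Derivatives of time-frequency shifts\<close>

text \<open>With S the shift of the sequence \<open>X\<close>, this is (z + S)^n (z + S) = (z +
  S)^(n+1), evaluated at index 0.\<close>

lemma binomial_sum_Suc:
  fixes z :: "'a::comm_semiring_1"
  shows "(\<Sum>k\<le>n. of_nat (n choose k) * z ^ (n - k) * (z * X k + X (Suc k))) =
         (\<Sum>k\<le>Suc n. of_nat (Suc n choose k) * z ^ (Suc n - k) * X k)"
proof -
  have "(\<Sum>k\<le>Suc n. of_nat (Suc n choose k) * z ^ (Suc n - k) * X k) =
        z ^ Suc n * X 0 + (\<Sum>k\<le>n. of_nat (n choose Suc k) * z ^ (n - k) * X (Suc k)) +
        (\<Sum>k\<le>n. of_nat (n choose k) * z ^ (n - k) * X (Suc k))"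
    by (subst sum.atMost_Suc_shift) (simp add: algebra_simps sum.distrib)
  also have "z ^ Suc n * X 0 + (\<Sum>k\<le>n. of_nat (n choose Suc k) * z ^ (n - k) * X (Suc k)) =
        (\<Sum>k\<le>Suc n. of_nat (n choose k) * z ^ (Suc n - k) * X k)"
    by (subst sum.atMost_Suc_shift) simp
  also have "\<dots> = (\<Sum>k\<le>n. of_nat (n choose k) * z ^ (n - k) * (z * X k))"
    by (auto intro!: sum.cong simp: Suc_diff_le mult_ac binomial_eq_0)
  finally show ?thesis
    by (simp add: sum.distrib[symmetric] distrib_left)
qed

lemma partial_deriv_pow_modulate:
  assumes "smooth g"
  shows "(partial_deriv i ^^ n) (modulate \<xi> g) =
    (\<lambda>y. \<Sum>k\<le>n. of_nat (n choose k) * (\<i> * of_real (\<xi> $ i)) ^ (n - k) * modulate \<xi> ((partial_deriv i ^^ k) g) y)"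
  using assms
proof (induction n arbitrary: g)
  case (Suc n)
  let ?z = "\<i> * complex_of_real (\<xi> $ i)"
  let ?g' = "\<lambda>y. ?z * g y + 1 * partial_deriv i g y"
  \<comment> \<open>The innermost derivative is peeled off, so the induction hypothesis is applied
    to \<open>?g'\<close> in place of \<open>g\<close>; hence the generalisation over
    \<open>g\<close>.\<close>
  have "(partial_deriv i ^^ Suc n) (modulate \<xi> g) = (partial_deriv i ^^ n) (modulate \<xi> ?g')"
    using partial_deriv_modulate[OF Suc.prems] by (simp add: funpow_swap1)
  also have "\<dots> = (\<lambda>y. \<Sum>k\<le>n. of_nat (n choose k) * ?z ^ (n - k) * modulate \<xi> ((partial_deriv i ^^ k) ?g') y)"
    by (intro Suc.IH smooth_lincomb smooth_partial_deriv Suc.prems)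
  also have "\<dots> = (\<lambda>y. \<Sum>k\<le>n. of_nat (n choose k) * ?z ^ (n - k) *
      (?z * modulate \<xi> ((partial_deriv i ^^ k) g) y + modulate \<xi> ((partial_deriv i ^^ Suc k) g) y))"
    by (subst partial_deriv_pow_lincomb[OF Suc.prems smooth_partial_deriv[OF Suc.prems]])
       (simp add: modulate_def funpow_swap1 algebra_simps)
  finally show ?case
    by (simp only: binomial_sum_Suc[where X = "\<lambda>k. modulate \<xi> ((partial_deriv i ^^ k) g) y" for y])
qed simp

text \<open>
  The hypothesis and the conclusion have the same product form in the coordinates of \<open>L\<close>, so the
  multivariate Leibniz rule is replaced by one one-dimensional step per coordinate.
\<close>

lemma foldr_partial_deriv_modulate_bound:
  fixes g :: "real ^ 'd::finite \<Rightarrow> complex" and L :: "'d list"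
  assumes "smooth g" "distinct L" "s > 0" "B \<ge> 0"
    and xi: "\<And>i n. \<bar>\<xi> $ i\<bar> ^ n \<le> E * fact n powr s"
    and "\<And>\<beta>. cmod (foldr (\<lambda>i. partial_deriv i ^^ \<beta> i) L g y) \<le> B * (\<Prod>i\<in>set L. fact (\<beta> i) powr s)"
  shows "cmod (foldr (\<lambda>i. partial_deriv i ^^ \<alpha> i) L (modulate \<xi> g) y) \<le>
         B * E ^ length L * (\<Prod>i\<in>set L. 2 ^ \<alpha> i * fact (\<alpha> i) powr s)"
  using assms(1,2,4,6)
\<comment> \<open>\<open>foldr\<close> over \<open>L @ [i]\<close> differentiates in direction
  \<open>i\<close> first, directly on the modulated function. The remaining list then meets the
  functions \<open>g\<^sub>k k\<close>, with \<open>B\<close> enlarged by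
  \<open>fact k powr s\<close>.\<close>
proof (induction L arbitrary: g B rule: rev_induct)
  case Nil
  thus ?case
    by (simp add: modulate_def norm_mult)
next
  case (snoc i L)
  let ?n = "\<alpha> i" and ?f = "\<lambda>\<beta> L. foldr (\<lambda>i. partial_deriv i ^^ \<beta> i) L"
  let ?P = "\<Prod>i\<in>set L. 2 ^ \<alpha> i * fact (\<alpha> i) powr s"
  define g\<^sub>k where "g\<^sub>k k = (partial_deriv i ^^ k) g" for k
  have i: "i \<notin> set L" and "distinct L"
    using snoc.prems by auto
  have E: "E \<ge> 0"
    using xi[of i 0] by simp
  have smooth: "smooth (g\<^sub>k k)" for k
    unfolding g\<^sub>k_def by (intro smooth_partial_deriv_pow snoc.prems)
  have IH: "cmod (?f \<alpha> L (modulate \<xi> (g\<^sub>k k)) y) \<le> B * fact k powr s * E ^ length L * ?P" for k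
  proof (rule snoc.IH[OF smooth \<open>distinct L\<close>])
    fix \<beta> :: "'d \<Rightarrow> nat"
    \<comment> \<open>As \<open>i\<close> is not in \<open>L\<close>, the value of
      \<open>\<beta>\<close> at \<open>i\<close> is free; setting it to \<open>k\<close> makes the
      hypothesis on \<open>g\<close> one on \<open>g\<^sub>k k\<close>.\<close>
    have "?f (\<beta>(i := k)) (L @ [i]) g = ?f \<beta> L (g\<^sub>k k)"
      using i by (auto simp: g\<^sub>k_def intro!: foldr_cong)
    moreover have "(\<Prod>j\<in>set (L @ [i]). fact ((\<beta>(i := k)) j) powr s) =
        fact k powr s * (\<Prod>j\<in>set L. fact (\<beta> j) powr s)"
      using i by (auto intro!: prod.cong)
    ultimately show "cmod (?f \<beta> L (g\<^sub>k k) y) \<le> B * fact k powr s * (\<Prod>j\<in>set L. fact (\<beta> j) powr s)"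
      using snoc.prems(4)[of "\<beta>(i := k)"] by (simp add: mult_ac)
  qed (use snoc.prems in auto)
  have P: "?P \<ge> 0"
    by (intro prod_nonneg) auto
  have term_le: "\<bar>\<xi> $ i\<bar> ^ (?n - k) * (B * fact k powr s * E ^ length L * ?P)
      \<le> B * E ^ Suc (length L) * fact ?n powr s * ?P" if "k \<le> ?n" for k
  proof -
    have "\<bar>\<xi> $ i\<bar> ^ (?n - k) * fact k powr s \<le> E * fact (?n - k) powr s * fact k powr s"
      using xi by (intro mult_right_mono) auto
    also have "\<dots> = E * (fact k * fact (?n - k)) powr s"
      by (simp add: powr_mult)
    also have "\<dots> \<le> E * fact ?n powr s"
      using E fact_mult_le[OF that] \<open>s > 0\<close> by (intro mult_left_mono powr_mono2) auto
    finally have "(\<bar>\<xi> $ i\<bar> ^ (?n - k) * fact k powr s) * (B * E ^ length L * ?P)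
        \<le> (E * fact ?n powr s) * (B * E ^ length L * ?P)"
      using E P snoc.prems by (intro mult_right_mono) auto
    thus ?thesis
      by (simp add: mult_ac)
  qed
  have "?f \<alpha> (L @ [i]) (modulate \<xi> g) = (\<lambda>y. \<Sum>k\<le>?n.
      (of_nat (?n choose k) * (\<i> * of_real (\<xi> $ i)) ^ (?n - k)) * ?f \<alpha> L (modulate \<xi> (g\<^sub>k k)) y)"
    using smooth unfolding foldr_append
    by (simp add: partial_deriv_pow_modulate[OF snoc.prems(1)] g\<^sub>k_def[symmetric]
        foldr_partial_deriv_pow_sum smooth_modulate)
  hence "cmod (?f \<alpha> (L @ [i]) (modulate \<xi> g) y) \<le> (\<Sum>k\<le>?n.
      cmod ((of_nat (?n choose k) * (\<i> * of_real (\<xi> $ i)) ^ (?n - k)) * ?f \<alpha> L (modulate \<xi> (g\<^sub>k k)) y))"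
    by (simp only: norm_sum)
  also have "\<dots> = (\<Sum>k\<le>?n. real (?n choose k) *
      (\<bar>\<xi> $ i\<bar> ^ (?n - k) * cmod (?f \<alpha> L (modulate \<xi> (g\<^sub>k k)) y)))"
    by (simp add: norm_mult norm_power mult_ac)
  also have "\<dots> \<le> (\<Sum>k\<le>?n. real (?n choose k) *
      (\<bar>\<xi> $ i\<bar> ^ (?n - k) * (B * fact k powr s * E ^ length L * ?P)))"
    using IH by (intro sum_mono mult_left_mono) auto
  also have "\<dots> \<le> (\<Sum>k\<le>?n. real (?n choose k) * (B * E ^ Suc (length L) * fact ?n powr s * ?P))"
    using term_le by (intro sum_mono mult_left_mono) auto
  also have "\<dots> = 2 ^ ?n * (B * E ^ Suc (length L) * fact ?n powr s * ?P)"
    unfolding sum_distrib_right[symmetric] of_nat_sum[symmetric] choose_row_sum by simp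
  also have "\<dots> = B * E ^ length (L @ [i]) * (\<Prod>i\<in>set (L @ [i]). 2 ^ \<alpha> i * fact (\<alpha> i) powr s)"
    using i by (simp add: mult_ac)
  finally show ?case .
qed

text \<open>At 0 the shifted window is evaluated at \<open>- x\<close>, where it decays at any rate
  \<open>A\<close>. Each coordinate contributes one factor
  \<open>exp (s * gs_weight s \<xi>)\<close>, whence \<open>CARD('d)\<close>;
  \<open>2 ^ mi_abs \<alpha>\<close> collects the binomial row sums.\<close>

lemma mi_D_modulate_translate_bound:
  assumes "s > 0" "t > 0" "A > 0" "\<psi> \<in> gs_space t s"
  obtains C where "C \<ge> 0"
    "\<And>\<alpha> (x :: real ^ 'd::finite) \<xi>. cmod (mi_D \<alpha> (modulate \<xi> (translate x \<psi>)) 0) \<le>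
       C * exp (s * CARD('d) * gs_weight s \<xi> - A * gs_weight t x) * (2 ^ mi_abs \<alpha> * mi_fact \<alpha> powr s)"
proof -
  obtain h' K where K: "K \<ge> 0"
    "\<And>(f :: real ^ 'd \<Rightarrow> complex) \<beta> x. f \<in> gs_space t s \<Longrightarrow>
       cmod (mi_deriv \<beta> f x) \<le>
         K * enn2real (gs_seminorm t s h' f) * 1 ^ mi_abs \<beta> * mi_fact \<beta> powr s * exp (- (A * gs_weight t x))"
    using gs_space_exp_decay[OF \<open>t > 0\<close> \<open>A > 0\<close>, of 1] by (metis zero_less_one)
  define C where "C = K * enn2real (gs_seminorm t s h' \<psi>)"
  have C: "C \<ge> 0"
    using K by (simp add: C_def)
  show ?thesis
  proof (rule that[OF C])
    fix \<alpha> :: "'d multiindex" and x \<xi> :: "real ^ 'd"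
    have "cmod (foldr (\<lambda>i. partial_deriv i ^^ \<beta> i) coords (translate x \<psi>) 0) \<le>
        (C * exp (- (A * gs_weight t x))) * (\<Prod>i\<in>set coords. fact (\<beta> i) powr s)" for \<beta> :: "'d multiindex"
    proof -
      have "cmod (mi_deriv \<beta> (translate x \<psi>) 0) = cmod (mi_deriv \<beta> \<psi> (- x))"
        using assms(4) by (simp add: mi_deriv_translate gs_spaceD(1)) (simp add: translate_def)
      also have "\<dots> \<le> C * mi_fact \<beta> powr s * exp (- (A * gs_weight t x))"
        using K(2)[OF assms(4), of \<beta> "- x"] by (simp add: C_def)
      finally show ?thesis
        by (simp add: mi_deriv_def mi_fact_powr coords_props mult_ac)
    qed
    moreover have "\<bar>\<xi> $ i\<bar> ^ n \<le> exp (s * gs_weight s \<xi>) * fact n powr s" for i n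
    proof -
      have "\<bar>\<xi> $ i\<bar> ^ n \<le> fact n powr s * exp (s * \<bar>\<xi> $ i\<bar> powr (1/s))"
        using assms by (intro power_le_fact_powr_exp) auto
      also have "\<dots> \<le> fact n powr s * exp (s * gs_weight s \<xi>)"
        using assms gs_weight_component[of \<xi> i s] by (intro mult_left_mono) auto
      finally show ?thesis
        by (simp add: mult.commute)
    qed
    ultimately have "cmod (mi_deriv \<alpha> (modulate \<xi> (translate x \<psi>)) 0) \<le>
        C * exp (- (A * gs_weight t x)) * exp (s * gs_weight s \<xi>) ^ length (coords :: 'd list) *
        (\<Prod>i\<in>set coords. 2 ^ \<alpha> i * fact (\<alpha> i) powr s)"
      unfolding mi_deriv_def using assms C
      by (intro foldr_partial_deriv_modulate_bound smooth_translate gs_spaceD(1) coords_props) auto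
    also have "length (coords :: 'd list) = CARD('d)"
      using coords_props distinct_card by metis
    also have "C * exp (- (A * gs_weight t x)) * exp (s * gs_weight s \<xi>) ^ CARD('d) *
        (\<Prod>i\<in>set coords. 2 ^ \<alpha> i * fact (\<alpha> i) powr s) =
        C * exp (s * CARD('d) * gs_weight s \<xi> - A * gs_weight t x) * (2 ^ mi_abs \<alpha> * mi_fact \<alpha> powr s)"
      by (simp add: coords_props prod.distrib mi_fact_powr power_mi_abs exp_of_nat_mult[symmetric]
          exp_diff exp_minus field_simps)
    finally show "cmod (mi_D \<alpha> (modulate \<xi> (translate x \<psi>)) 0) \<le>
        C * exp (s * CARD('d) * gs_weight s \<xi> - A * gs_weight t x) * (2 ^ mi_abs \<alpha> * mi_fact \<alpha> powr s)"
      by (simp only: cmod_mi_D)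
  qed
qed

text \<open>\<open>Y\<close> keeps one coordinate away from 0 and \<open>Z\<close> is a ball about
  the origin, so homogeneity compares both weights with multiples of \<open>\<rho>\<close>.
  \<open>Y\<close> and \<open>Z\<close> precede \<open>r\<close> because a single neighbourhood in
  the wave front condition must serve all \<open>r\<close>.\<close>

lemma gs_weight_scaling:
  fixes y\<^sub>0 z\<^sub>0 :: "real ^ 'd::finite"
  assumes "s > 0" "t > 0" "B \<ge> 0" "y\<^sub>0 \<noteq> 0"
  obtains Y Z where "open Y" "open Z" "y\<^sub>0 \<in> Y" "z\<^sub>0 \<in> Z" "0 \<notin> Y"
    "\<And>r. r > 0 \<Longrightarrow> \<exists>A>0. \<forall>\<rho>>0. \<forall>y\<in>Y. \<forall>z\<in>Z.
       r * \<rho> + B * gs_weight s (\<rho> powr s *\<^sub>R z) \<le> A * gs_weight t (\<rho> powr t *\<^sub>R y)"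
proof -
  obtain i where i: "y\<^sub>0 $ i \<noteq> 0"
    using assms(4) by (auto simp: vec_eq_iff)
  define \<delta> where "\<delta> = \<bar>y\<^sub>0 $ i\<bar> / 2"
  define R where "R = norm z\<^sub>0 + 1"
  have \<delta>: "\<delta> > 0" and R: "R > 0"
    using i by (auto simp: \<delta>_def R_def add_nonneg_pos)
  show ?thesis
  proof (rule that[of "{y. \<delta> < \<bar>y $ i\<bar>}" "{z. norm z < R}"])
    show "open {y :: real ^ 'd. \<delta> < \<bar>y $ i\<bar>}" "open {z :: real ^ 'd. norm z < R}"
      by (intro open_Collect_less continuous_intros)+
    fix r :: real assume r: "r > 0"
    \<comment> \<open>Equates the two linear bounds: \<open>A * \<delta> powr (1/t)\<close> is
      \<open>r\<close> plus the largest slope of the term with \<open>B\<close>.\<close>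
    define A where "A = (r + B * (CARD('d) * R powr (1/s))) / \<delta> powr (1/t)"
    have A: "A > 0"
      unfolding A_def using r \<delta> assms by (intro divide_pos_pos add_pos_nonneg) auto
    have "r * \<rho> + B * gs_weight s (\<rho> powr s *\<^sub>R z) \<le> A * gs_weight t (\<rho> powr t *\<^sub>R y)"
      if "\<rho> > 0" "\<delta> < \<bar>y $ i\<bar>" "norm z < R" for \<rho> and y z :: "real ^ 'd"
    proof -
      have "gs_weight s (\<rho> powr s *\<^sub>R z) \<le> CARD('d) * R powr (1/s) * \<rho>"
        using that component_le_norm_cart[of z] assms
        by (intro gs_weight_scale_le) (auto intro: order_trans less_imp_le)
      hence "r * \<rho> + B * gs_weight s (\<rho> powr s *\<^sub>R z) \<le> r * \<rho> + B * (CARD('d) * R powr (1/s) * \<rho>)"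
        using assms by (intro add_left_mono mult_left_mono) auto
      also have "\<dots> = A * (\<delta> powr (1/t) * \<rho>)"
        using \<delta> by (simp add: A_def field_simps)
      also have "\<dots> \<le> A * (\<bar>y $ i\<bar> powr (1/t) * \<rho>)"
        using that \<delta> assms A by (intro mult_left_mono mult_right_mono powr_mono2) auto
      also have "\<bar>y $ i\<bar> powr (1/t) * \<rho> = \<bar>(\<rho> powr t *\<^sub>R y) $ i\<bar> powr (1/t)"
        using that assms by (simp add: abs_mult powr_mult powr_powr mult.commute)
      also have "A * \<dots> \<le> A * gs_weight t (\<rho> powr t *\<^sub>R y)"
        using A by (intro mult_left_mono gs_weight_component) auto
      finally show ?thesis .
    qed
    thus "\<exists>A>0. \<forall>\<rho>>0. \<forall>y\<in>{y. \<delta> < \<bar>y $ i\<bar>}. \<forall>z\<in>{z :: real ^ 'd. norm z < R}.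
        r * \<rho> + B * gs_weight s (\<rho> powr s *\<^sub>R z) \<le> A * gs_weight t (\<rho> powr t *\<^sub>R y)"
      using A by (intro exI[of _ A]) auto
  qed (use i \<delta> in \<open>auto simp: \<delta>_def R_def\<close>)
qed

section \<open>Integrals against monomials\<close>

lemma continuous_on_mi_pow [continuous_intros]: "continuous_on S (\<lambda>y. mi_pow y \<alpha>)"
  unfolding mi_pow_def by (intro continuous_intros)

lemma borel_measurable_mi_pow [measurable]:
  "(\<lambda>y :: real ^ 'd::finite. mi_pow y \<alpha>) \<in> borel_measurable borel"
  by (intro borel_measurable_continuous_onI continuous_intros)

text \<open>If \<open>\<beta> i = 0\<close>, the truncated exponent \<open>\<beta> i - 1\<close> is
  harmless because its coefficient vanishes, so integration by parts needs no case
  distinction.\<close>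

lemma has_derivative_mi_pow:
  obtains D where "((\<lambda>y. mi_pow y \<beta>) has_derivative D) (at y)"
    "D (axis i 1) = \<beta> i * mi_pow y (\<beta>(i := \<beta> i - 1))"
proof -
  define D where "D v = (\<Sum>j\<in>UNIV. (of_nat (\<beta> j) * (v $ j * y $ j ^ (\<beta> j - 1))) *
    (\<Prod>k\<in>UNIV - {j}. (y $ k) ^ \<beta> k))" for v
  have comp: "((\<lambda>y. y $ j) has_derivative (\<lambda>v. v $ j)) (at y)" for j
    by (rule bounded_linear.has_derivative[OF bounded_linear_vec_nth has_derivative_ident])
  have "((\<lambda>y. mi_pow y \<beta>) has_derivative D) (at y)"
    unfolding mi_pow_def D_def
    by (rule has_derivative_prod, rule has_derivative_eq_rhs[OF has_derivative_power[OF comp]])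
       (simp add: mult_ac)
  moreover have "D (axis i 1) = \<beta> i * mi_pow y (\<beta>(i := \<beta> i - 1))"
  proof -
    have "D (axis i 1) = (\<Sum>j\<in>UNIV. if j = i then
        (of_nat (\<beta> i) * y $ i ^ (\<beta> i - 1)) * (\<Prod>k\<in>UNIV - {i}. (y $ k) ^ \<beta> k) else 0)"
      unfolding D_def by (intro sum.cong) (auto simp: axis_def)
    also have "\<dots> = of_nat (\<beta> i) * (y $ i ^ (\<beta> i - 1) * (\<Prod>k\<in>UNIV - {i}. (y $ k) ^ \<beta> k))"
      by (simp add: mult_ac)
    also have "y $ i ^ (\<beta> i - 1) * (\<Prod>k\<in>UNIV - {i}. (y $ k) ^ \<beta> k) = mi_pow y (\<beta>(i := \<beta> i - 1))"
      unfolding mi_pow_def by (subst (2) prod.remove[of _ i]) auto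
    finally show ?thesis .
  qed
  ultimately show ?thesis
    using that by blast
qed

lemma
  assumes "smooth \<phi>"
  shows differentiable_mi_pow_cnj:
      "(\<lambda>y. of_real (mi_pow y \<beta>) * cnj (\<phi> y)) differentiable (at y)"
    and partial_deriv_mi_pow_cnj:
      "partial_deriv i (\<lambda>y. of_real (mi_pow y \<beta>) * cnj (\<phi> y)) y =
         of_nat (\<beta> i) * (of_real (mi_pow y (\<beta>(i := \<beta> i - 1))) * cnj (\<phi> y)) +
         of_real (mi_pow y \<beta>) * cnj (partial_deriv i \<phi> y)"
proof -
  obtain D where D: "((\<lambda>y. mi_pow y \<beta>) has_derivative D) (at y)"
    "D (axis i 1) = \<beta> i * mi_pow y (\<beta>(i := \<beta> i - 1))"
    by (rule has_derivative_mi_pow)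
  have "(\<phi> has_derivative frechet_derivative \<phi> (at y)) (at y)"
    using smooth_differentiable[OF assms] frechet_derivative_works by blast
  from has_derivative_mult[OF bounded_linear.has_derivative[OF bounded_linear_of_real D(1)]
      bounded_linear.has_derivative[OF bounded_linear_cnj this]]
  have *: "((\<lambda>y. complex_of_real (mi_pow y \<beta>) * cnj (\<phi> y)) has_derivative
     (\<lambda>v. of_real (mi_pow y \<beta>) * cnj (frechet_derivative \<phi> (at y) v) + of_real (D v) * cnj (\<phi> y))) (at y)" .
  show "(\<lambda>y. of_real (mi_pow y \<beta>) * cnj (\<phi> y)) differentiable (at y)"
    using * by (rule differentiableI)
  show "partial_deriv i (\<lambda>y. of_real (mi_pow y \<beta>) * cnj (\<phi> y)) y =
         of_nat (\<beta> i) * (of_real (mi_pow y (\<beta>(i := \<beta> i - 1))) * cnj (\<phi> y)) +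
         of_real (mi_pow y \<beta>) * cnj (partial_deriv i \<phi> y)"
    unfolding has_derivative_partial_deriv[OF *] D(2) by (simp add: partial_deriv_def)
qed

text \<open>Of the rate \<open>s + 1\<close>, the part \<open>s\<close> cancels the growth of the
  monomial and the part 1 is left over as an integrable weight.\<close>

lemma mi_pow_cnj_bound:
  assumes "s > 0" and decay: "cmod (\<phi> y) \<le> N * exp (- ((s + 1) * gs_weight s y))"
  shows "cmod (of_real (mi_pow y \<alpha>) * cnj (\<phi> y)) \<le> mi_fact \<alpha> powr s * (N * exp (- gs_weight s y))"
proof -
  have "cmod (of_real (mi_pow y \<alpha>) * cnj (\<phi> y)) = \<bar>mi_pow y \<alpha>\<bar> * cmod (\<phi> y)"
    by (simp add: norm_mult)
  also have "\<dots> \<le> (mi_fact \<alpha> powr s * exp (s * gs_weight s y)) * (N * exp (- ((s + 1) * gs_weight s y)))"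
    using assms by (intro mult_mono mi_pow_le_weight) auto
  also have "\<dots> = mi_fact \<alpha> powr s * (N * exp (s * gs_weight s y + - ((s + 1) * gs_weight s y)))"
    by (simp only: exp_add mult_ac)
  also have "s * gs_weight s y + - ((s + 1) * gs_weight s y) = - gs_weight s y"
    by (simp add: algebra_simps)
  finally show ?thesis .
qed

lemma
  fixes \<phi> :: "real ^ 'd::finite \<Rightarrow> complex"
  assumes s: "s > 0" and cont: "continuous_on UNIV \<phi>"
    and decay: "\<And>y. cmod (\<phi> y) \<le> N * exp (- ((s + 1) * gs_weight s y))"
  shows integrable_mi_pow_cnj:
      "integrable lborel (\<lambda>y. of_real (mi_pow y \<alpha>) * cnj (\<phi> y))"
    and integral_mi_pow_cnj_bound:
      "cmod (LINT y|lborel. of_real (mi_pow y \<alpha>) * cnj (\<phi> y)) \<le>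
         mi_fact \<alpha> powr s * N * (LINT y|lborel. exp (- gs_weight s (y :: real ^ 'd)))"
proof -
  have [measurable]: "(\<lambda>y. of_real (mi_pow y \<alpha>) * cnj (\<phi> y)) \<in> borel_measurable borel"
    by (intro borel_measurable_continuous_onI continuous_intros cont)
  have int: "integrable lborel (\<lambda>y :: real ^ 'd. mi_fact \<alpha> powr s * (N * exp (- gs_weight s y)))"
    by (intro integrable_mult_right integrable_exp_minus_gs_weight s)
  show int': "integrable lborel (\<lambda>y. of_real (mi_pow y \<alpha>) * cnj (\<phi> y))"
    by (rule Bochner_Integration.integrable_bound[OF int])
       (auto intro!: always_eventually order_trans[OF mi_pow_cnj_bound[where \<phi> = \<phi>, OF s decay]])
  have "cmod (LINT y|lborel. of_real (mi_pow y \<alpha>) * cnj (\<phi> y)) \<le>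
      (LINT y|lborel. mi_fact \<alpha> powr s * (N * exp (- gs_weight s (y :: real ^ 'd))))"
    by (rule Bochner_Integration.integral_norm_bound_integral) (use int int' mi_pow_cnj_bound[where \<phi> = \<phi>, OF s decay] in auto)
  thus "cmod (LINT y|lborel. of_real (mi_pow y \<alpha>) * cnj (\<phi> y)) \<le>
         mi_fact \<alpha> powr s * N * (LINT y|lborel. exp (- gs_weight s (y :: real ^ 'd)))"
    by simp
qed

text \<open>The two decay hypotheses make the product and its partial derivative integrable, so
  there is no boundary term.\<close>

lemma integral_mi_pow_cnj_by_parts:
  fixes \<phi> :: "real ^ 'd::finite \<Rightarrow> complex"
  assumes s: "s > 0" and \<phi>: "smooth \<phi>"
    and decay: "\<And>y. cmod (\<phi> y) \<le> N * exp (- ((s + 1) * gs_weight s y))"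
      "\<And>y. cmod (partial_deriv i \<phi> y) \<le> N' * exp (- ((s + 1) * gs_weight s y))"
  shows "of_nat (\<beta> i) * (LINT y|lborel. of_real (mi_pow y (\<beta>(i := \<beta> i - 1))) * cnj (\<phi> y)) +
         (LINT y|lborel. of_real (mi_pow y \<beta>) * cnj (partial_deriv i \<phi> y)) = 0"
proof -
  let ?G = "\<lambda>y. of_real (mi_pow y \<beta>) * cnj (\<phi> y)"
  note \<phi>' = smooth_partial_deriv[OF \<phi>, of i]
  note pd = partial_deriv_mi_pow_cnj[OF \<phi>, of i \<beta>, abs_def]
  note int = integrable_mi_pow_cnj[OF s smooth_continuous_on[OF \<phi>] decay(1)]
    integrable_mi_pow_cnj[OF s smooth_continuous_on[OF \<phi>'] decay(2)]
  have "(LINT y|lborel. partial_deriv i ?G y) = 0"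
  proof (rule integral_partial_deriv_eq_0)
    show "continuous_on UNIV (partial_deriv i ?G)"
      unfolding pd by (intro continuous_intros smooth_continuous_on \<phi> \<phi>')
    show "integrable lborel (partial_deriv i ?G)"
      unfolding pd using int by simp
  qed (use int differentiable_mi_pow_cnj[OF \<phi>] in auto)
  thus ?thesis
    unfolding pd using int by simp
qed

text \<open>Multiplication by \<open>z\<close> acts as the sum of two commuting operators, one
  lowering \<open>p\<close> and one raising \<open>m\<close>; this is their binomial theorem. The
  falling factorial \<open>fact k * (p choose k)\<close> vanishes for \<open>k > p\<close>, where
  \<open>p - k\<close> is truncated.\<close>

lemma power_mult_iterate_recursion:
  fixes J :: "nat \<Rightarrow> nat \<Rightarrow> complex"
  assumes rec: "\<And>p m. z * J p m = of_nat p * J (p - 1) m + J p (Suc m)"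
  shows "z ^ n * J p m =
    (\<Sum>k\<le>n. of_nat (n choose k) * (of_nat (fact k * (p choose k)) * J (p - k) (m + n - k)))"
proof (induction n arbitrary: p m)
  case (Suc n)
  define X where "X k = of_nat (fact k * (p choose k)) * J (p - k) (m + Suc n - k)" for k
  have absorb: "of_nat p * (of_nat (fact k * (p - 1 choose k)) * J (p - 1 - k) (m + n - k)) = X (Suc k)" for k
  proof -
    have "p * (fact k * (p - 1 choose k)) = fact (Suc k) * (p choose Suc k)"
    proof (cases p)
      case (Suc q)
      have "Suc q * (fact k * (q choose k)) = fact k * (Suc q * (q choose k))"
        by (simp only: mult_ac)
      also have "\<dots> = fact k * (Suc k * (Suc q choose Suc k))"
        by (simp only: Suc_times_binomial)
      also have "\<dots> = fact (Suc k) * (Suc q choose Suc k)"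
        by (simp only: fact_Suc of_nat_id mult_ac)
      finally show ?thesis
        using Suc by simp
    qed simp
    thus ?thesis
      unfolding X_def by (metis (no_types, lifting) Suc_diff_Suc add_Suc_right diff_Suc_Suc
          diff_Suc_eq_diff_pred mult.assoc of_nat_mult)
  qed
  have "z ^ Suc n * J p m = z ^ n * (z * J p m)"
    by simp
  also have "\<dots> = of_nat p * (z ^ n * J (p - 1) m) + z ^ n * J p (Suc m)"
    unfolding rec by (simp add: algebra_simps)
  \<comment> \<open>The factors 1 bring the sum into the form of \<open>binomial_sum_Suc\<close>
    with \<open>z = 1\<close>.\<close>
  also have "\<dots> = (\<Sum>k\<le>n. of_nat (n choose k) * 1 ^ (n - k) * (1 * X k + X (Suc k)))"
    unfolding Suc.IH sum_distrib_left sum.distrib[symmetric]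
  proof (intro sum.cong refl)
    fix k
    have "J p' (Suc m + n - k) = J p' (m + Suc n - k)" for p'
      by simp
    thus "of_nat p * (of_nat (n choose k) * (of_nat (fact k * (p - 1 choose k)) * J (p - 1 - k) (m + n - k))) +
        of_nat (n choose k) * (of_nat (fact k * (p choose k)) * J (p - k) (Suc m + n - k)) =
        of_nat (n choose k) * 1 ^ (n - k) * (1 * X k + X (Suc k))"
      unfolding absorb[symmetric] by (simp add: X_def algebra_simps)
  qed
  finally show ?case
    unfolding binomial_sum_Suc by (simp add: X_def)
qed simp

text \<open>
  The derivatives that fall on the monomial cost a factor \<open>k!\<close>, which \<open>s + t \<ge> 1\<close> allows to be
  distributed over the two Gevrey factorials.
\<close>

lemma gevrey_recursion_bound:
  fixes J :: "nat \<Rightarrow> nat \<Rightarrow> complex"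
  assumes rec: "\<And>p m. z * J p m = of_nat p * J (p - 1) m + J p (Suc m)"
    and J: "\<And>p m. cmod (J p m) \<le> M * fact p powr s * h ^ m * fact m powr t"
    and "M \<ge> 0" "0 < h" "h \<le> 1" "s > 0" "t > 0" "s + t \<ge> 1"
  shows "cmod z ^ n * cmod (J p 0) \<le> M * (2 / h) ^ p * fact p powr s * (2 * h) ^ n * fact n powr t"
proof -
  define Q where "Q = M * (2 / h) ^ p * fact p powr s * h ^ n * fact n powr t"
  have term_le: "real (fact k * (p choose k)) * cmod (J (p - k) (0 + n - k)) \<le> Q" if k: "k \<le> n" for k
  proof (cases "k \<le> p")
    case True
    have "(fact k :: real) \<le> fact k powr (s + t)"
      using assms fact_ge_1[of k, where 'a = real] powr_mono[of 1 "s + t" "fact k :: real"] by simp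
    hence "fact k * fact (p - k) powr s * fact (n - k) powr t \<le>
        fact k powr (s + t) * fact (p - k) powr s * fact (n - k) powr t"
      by (intro mult_right_mono) auto
    also have "\<dots> = (fact k * fact (p - k)) powr s * (fact k * fact (n - k)) powr t"
      by (simp add: powr_add powr_mult)
    also have "\<dots> \<le> fact p powr s * fact n powr t"
      using assms True k by (intro mult_mono powr_mono2 fact_mult_le) auto
    finally have 1: "fact k * fact (p - k) powr s * fact (n - k) powr t \<le> fact p powr s * fact n powr t" .
    have "real (p choose k) \<le> 2 ^ p"
      using binomial_le_pow2[of p k] by (metis numeral_power_eq_of_nat_cancel_iff of_nat_mono of_nat_numeral of_nat_power)
    \<comment> \<open>The \<open>k\<close> missing powers of \<open>h\<close> are repaid by
      \<open>(1 / h) ^ p\<close>, since \<open>k \<le> p\<close> and \<open>h \<le> 1\<close>; this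
      is the source of \<open>(2 / h) ^ p\<close>.\<close>
    moreover have "h ^ (n - k) \<le> h ^ n * (1 / h) ^ p"
    proof -
      have "h ^ (n - k) = h ^ n * (1 / h) ^ k"
        using k assms by (simp add: power_diff power_divide)
      also have "\<dots> \<le> h ^ n * (1 / h) ^ p"
        using True assms by (intro mult_left_mono power_increasing) auto
      finally show ?thesis .
    qed
    ultimately have 2: "real (p choose k) * h ^ (n - k) \<le> 2 ^ p * (h ^ n * (1 / h) ^ p)"
      using assms by (intro mult_mono) auto
    have "real (fact k * (p choose k)) * cmod (J (p - k) (0 + n - k)) \<le>
        real (fact k * (p choose k)) * (M * fact (p - k) powr s * h ^ (n - k) * fact (n - k) powr t)"
      using J[of "p - k" "n - k"] by (intro mult_left_mono) auto
    also have "\<dots> = M * ((real (p choose k) * h ^ (n - k)) *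
        (fact k * fact (p - k) powr s * fact (n - k) powr t))"
      by (simp add: mult_ac)
    also have "\<dots> \<le> M * ((2 ^ p * (h ^ n * (1 / h) ^ p)) * (fact p powr s * fact n powr t))"
      using assms by (intro mult_left_mono mult_mono[OF 2 1]) auto
    also have "\<dots> = Q"
      by (simp add: Q_def power_divide mult_ac)
    finally show ?thesis .
  next
    case False
    thus ?thesis
      using assms by (simp add: Q_def binomial_eq_0)
  qed
  have "cmod z ^ n * cmod (J p 0) = cmod (z ^ n * J p 0)"
    by (simp add: norm_mult norm_power)
  also have "\<dots> \<le> (\<Sum>k\<le>n. cmod (of_nat (n choose k) * (of_nat (fact k * (p choose k)) * J (p - k) (0 + n - k))))"
    unfolding power_mult_iterate_recursion[where J = J, OF rec] by (rule norm_sum)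
  also have "\<dots> = (\<Sum>k\<le>n. real (n choose k) * (real (fact k * (p choose k)) * cmod (J (p - k) (0 + n - k))))"
    by (simp only: norm_mult norm_of_nat)
  also have "\<dots> \<le> (\<Sum>k\<le>n. real (n choose k) * Q)"
    using term_le by (intro sum_mono mult_left_mono) auto
  also have "\<dots> = 2 ^ n * Q"
    unfolding sum_distrib_right[symmetric] of_nat_sum[symmetric] choose_row_sum by simp
  also have "\<dots> = M * (2 / h) ^ p * fact p powr s * (2 * h) ^ n * fact n powr t"
    by (simp add: Q_def power_mult_distrib mult_ac)
  finally show ?thesis .
qed

section \<open>The power series\<close>

lemma summable_coefficients:
  assumes "\<And>r::real. r > 0 \<Longrightarrow> (\<lambda>\<alpha>. cmod (c \<alpha>) * r ^ mi_abs \<alpha> * mi_fact \<alpha> powr s) summable_on UNIV"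
  shows "(\<lambda>\<alpha>. cmod (c \<alpha>) * mi_fact \<alpha> powr s) summable_on UNIV"
  using assms[of 1] by simp

text \<open>
  In the second bound \<open>n\<close> is free, so small \<open>h\<close> means fast decay in \<open>\<xi>\<close>. The price \<open>(2 / h) ^ mi_abs \<alpha>\<close>
  is harmless because the coefficients are summable against every \<open>r ^ mi_abs \<alpha>\<close>.
\<close>

lemma stft_monomial_bound:
  fixes \<eta> :: "real ^ 'd::finite \<Rightarrow> complex" and x \<xi> :: "real ^ 'd"
  defines "\<phi> \<equiv> modulate \<xi> (translate x \<eta>)"
  assumes s: "s > 0" and t: "t > 0" and st: "s + t \<ge> 1" and h: "0 < h" "h \<le> 1" and "M \<ge> 0"
    and \<eta>: "smooth \<eta>"
    and decay: "\<And>i m y. cmod ((partial_deriv i ^^ m) \<eta> y) \<le>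
      M * h ^ m * fact m powr t * exp (- (2 powr (1/s) * (s + 1) * gs_weight s y))"
  shows "\<And>y. cmod (\<phi> y) \<le> M * exp (2 powr (1/s) * (s + 1) * gs_weight s x) * exp (- ((s + 1) * gs_weight s y))"
    and "\<And>i n \<alpha>. \<bar>\<xi> $ i\<bar> ^ n * cmod (LINT y|lborel. of_real (mi_pow y \<alpha>) * cnj (\<phi> y)) \<le>
      M * exp (2 powr (1/s) * (s + 1) * gs_weight s x) *
      (LINT y|lborel. exp (- gs_weight s (y :: real ^ 'd))) *
      ((2 / h) ^ mi_abs \<alpha> * mi_fact \<alpha> powr s) * (2 * h) ^ n * fact n powr t"
proof -
  define B where "B = 2 powr (1/s) * (s + 1)"
  define N where "N = M * exp (B * gs_weight s x)"
  define J\<^sub>0 where "J\<^sub>0 = (LINT y|lborel. exp (- gs_weight s (y :: real ^ 'd)))"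
  \<comment> \<open>The shift of a derivative of the window, not a derivative of
    \<open>\<phi>\<close>: its size does not depend on \<open>\<xi>\<close>, and
    \<open>\<xi>\<close> appears only through the recursion below.\<close>
  define \<phi>' where "\<phi>' i m = modulate \<xi> (translate x ((partial_deriv i ^^ m) \<eta>))" for i m
  have J\<^sub>0: "J\<^sub>0 \<ge> 0"
    unfolding J\<^sub>0_def by (intro integral_nonneg_AE) auto
  have smooth: "smooth (\<phi>' i m)" for i m
    unfolding \<phi>'_def by (intro smooth_modulate smooth_translate smooth_partial_deriv_pow \<eta>)
  have decay': "cmod (\<phi>' i m y) \<le> N * h ^ m * fact m powr t * exp (- ((s + 1) * gs_weight s y))" for i m y
  proof -
    \<comment> \<open>Writing y as (y - x) + x trades decay in y - x for decay in y at the cost of a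
      factor growing in \<open>x\<close>.\<close>
    have "(s + 1) * gs_weight s (y - x + x) \<le> (s + 1) * (2 powr (1/s) * (gs_weight s (y - x) + gs_weight s x))"
      using s by (intro mult_left_mono gs_weight_add) auto
    hence weight: "- (B * gs_weight s (y - x)) \<le> B * gs_weight s x + - ((s + 1) * gs_weight s y)"
      by (simp add: B_def algebra_simps)
    have "cmod (\<phi>' i m y) = cmod ((partial_deriv i ^^ m) \<eta> (y - x))"
      by (simp add: \<phi>'_def modulate_def translate_def norm_mult)
    also have "\<dots> \<le> M * h ^ m * fact m powr t * exp (- (B * gs_weight s (y - x)))"
      using decay[where i = i and m = m and y = "y - x"] by (simp add: B_def)
    also have "\<dots> \<le> M * h ^ m * fact m powr t * exp (B * gs_weight s x + - ((s + 1) * gs_weight s y))"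
      using weight \<open>M \<ge> 0\<close> h by (intro mult_left_mono) auto
    also have "\<dots> = N * h ^ m * fact m powr t * exp (- ((s + 1) * gs_weight s y))"
      by (simp only: N_def exp_add mult_ac)
    finally show ?thesis .
  qed
  have \<phi>: "\<phi> = \<phi>' i 0" for i
    by (simp add: \<phi>_def \<phi>'_def)
  show "cmod (\<phi> y) \<le> M * exp (2 powr (1/s) * (s + 1) * gs_weight s x) * exp (- ((s + 1) * gs_weight s y))" for y
    \<comment> \<open>\<open>\<phi>\<close> equals \<open>\<phi>' i 0\<close> for every
      \<open>i\<close>, so an arbitrary coordinate can be inserted.\<close>
    using decay'[where m = 0] by (simp add: \<phi>[of undefined] N_def B_def)
  fix i :: 'd and n :: nat and \<alpha> :: "'d multiindex"
  \<comment> \<open>Only the \<open>i\<close>-th exponent varies, the others stay frozen at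
    \<open>\<alpha>\<close>; this makes the recursion one-dimensional.\<close>
  define J where "J p m = (LINT y|lborel. of_real (mi_pow y (\<alpha>(i := p))) * cnj (\<phi>' i m y))" for p m
  note int = integrable_mi_pow_cnj[OF s smooth_continuous_on[OF smooth] decay']
  define P where "P = (\<Prod>j\<in>UNIV - {i}. fact (\<alpha> j) powr s)"
  have P: "P \<ge> 0"
    unfolding P_def by (intro prod_nonneg) auto
  have fact_upd: "mi_fact (\<alpha>(i := p)) powr s = fact p powr s * P" for p
    unfolding mi_fact_powr P_def by (subst prod.remove[of _ i]) (auto intro!: prod.cong)
  have pd: "partial_deriv i (\<phi>' i m) = (\<lambda>y. \<i> * of_real (\<xi> $ i) * \<phi>' i m y + \<phi>' i (Suc m) y)" for m
    unfolding \<phi>'_def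
    by (subst partial_deriv_modulate, intro smooth_translate smooth_partial_deriv_pow \<eta>)
       (auto simp: partial_deriv_translate smooth_partial_deriv_pow \<eta> modulate_def algebra_simps)
  have rec: "(\<i> * of_real (\<xi> $ i)) * J p m = of_nat p * J (p - 1) m + J p (Suc m)" for p m
  proof -
    \<comment> \<open>This constant depends on \<open>\<xi>\<close>, which does no harm: it only
      secures integrability and does not appear in the identity obtained.\<close>
    let ?N' = "\<bar>\<xi> $ i\<bar> * (N * h ^ m * fact m powr t) + N * h ^ Suc m * fact (Suc m) powr t"
    have "cmod (partial_deriv i (\<phi>' i m) y) \<le> ?N' * exp (- ((s + 1) * gs_weight s y))" for y
    proof -
      have "cmod (partial_deriv i (\<phi>' i m) y) \<le> \<bar>\<xi> $ i\<bar> * cmod (\<phi>' i m y) + cmod (\<phi>' i (Suc m) y)"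
        unfolding pd by (rule order_trans[OF norm_triangle_ineq]) (simp add: norm_mult)
      also have "\<dots> \<le> \<bar>\<xi> $ i\<bar> * (N * h ^ m * fact m powr t * exp (- ((s + 1) * gs_weight s y))) +
          N * h ^ Suc m * fact (Suc m) powr t * exp (- ((s + 1) * gs_weight s y))"
        by (intro add_mono mult_left_mono decay') auto
      also have "\<dots> = ?N' * exp (- ((s + 1) * gs_weight s y))"
        by (simp add: algebra_simps del: power_Suc fact_Suc)
      finally show ?thesis .
    qed
    from integral_mi_pow_cnj_by_parts[OF s smooth decay' this, where \<beta> = "\<alpha>(i := p)"]
    have "of_nat p * J (p - 1) m +
        (LINT y|lborel. of_real (mi_pow y (\<alpha>(i := p))) * cnj (partial_deriv i (\<phi>' i m) y)) = 0"
      by (simp add: J_def)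
    \<comment> \<open>Conjugation turns the factor i \<xi>_i from \<open>pd\<close> into its
      negative, which yields the sign in \<open>rec\<close>.\<close>
    also have "(LINT y|lborel. of_real (mi_pow y (\<alpha>(i := p))) * cnj (partial_deriv i (\<phi>' i m) y)) =
        (LINT y|lborel. - (\<i> * of_real (\<xi> $ i)) * (of_real (mi_pow y (\<alpha>(i := p))) * cnj (\<phi>' i m y)) +
          of_real (mi_pow y (\<alpha>(i := p))) * cnj (\<phi>' i (Suc m) y))"
      unfolding pd by (intro Bochner_Integration.integral_cong) (auto simp: algebra_simps)
    also have "\<dots> = - (\<i> * of_real (\<xi> $ i)) * J p m + J p (Suc m)"
      unfolding J_def
      by (subst Bochner_Integration.integral_add) (intro integrable_mult_right int, rule int, simp)
    finally show ?thesis
      by (simp add: algebra_simps add_eq_0_iff)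
  qed
  have "cmod (J p m) \<le> (N * J\<^sub>0 * P) * fact p powr s * h ^ m * fact m powr t" for p m
    using integral_mi_pow_cnj_bound[OF s smooth_continuous_on[OF smooth] decay', where \<alpha> = "\<alpha>(i := p)"]
    unfolding J_def J\<^sub>0_def fact_upd by (simp add: mult_ac)
  from gevrey_recursion_bound[where J = J and p = "\<alpha> i" and n = n, OF rec this]
  have "cmod (\<i> * of_real (\<xi> $ i)) ^ n * cmod (J (\<alpha> i) 0) \<le>
      (N * J\<^sub>0 * P) * (2 / h) ^ \<alpha> i * fact (\<alpha> i) powr s * (2 * h) ^ n * fact n powr t"
    using s t st h P J\<^sub>0 \<open>M \<ge> 0\<close> by (simp add: N_def)
  also have "\<dots> = N * J\<^sub>0 * ((2 / h) ^ \<alpha> i * mi_fact \<alpha> powr s) * (2 * h) ^ n * fact n powr t"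
    using fact_upd[of "\<alpha> i"] by (simp add: mult_ac)
  \<comment> \<open>As \<open>2 / h \<ge> 1\<close>, the exponent can be raised to
    \<open>mi_abs \<alpha>\<close>; the bound then no longer depends on the chosen
    coordinate.\<close>
  also have "\<dots> \<le> N * J\<^sub>0 * ((2 / h) ^ mi_abs \<alpha> * mi_fact \<alpha> powr s) * (2 * h) ^ n * fact n powr t"
  proof -
    have "\<alpha> i \<le> mi_abs \<alpha>"
      unfolding mi_abs_def by (intro member_le_sum) auto
    thus ?thesis
      using h J\<^sub>0 \<open>M \<ge> 0\<close> unfolding N_def
      by (intro mult_right_mono mult_left_mono power_increasing) auto
  qed
  finally show "\<bar>\<xi> $ i\<bar> ^ n * cmod (LINT y|lborel. of_real (mi_pow y \<alpha>) * cnj (\<phi> y)) \<le>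
      M * exp (2 powr (1/s) * (s + 1) * gs_weight s x) *
      (LINT y|lborel. exp (- gs_weight s (y :: real ^ 'd))) *
      ((2 / h) ^ mi_abs \<alpha> * mi_fact \<alpha> powr s) * (2 * h) ^ n * fact n powr t"
    by (simp add: J_def J\<^sub>0_def N_def B_def \<phi>[of i] norm_mult)
qed

lemma
  fixes \<phi> :: "real ^ 'd::finite \<Rightarrow> complex"
  assumes s: "s > 0" and c: "(\<lambda>\<alpha>. cmod (c \<alpha>) * mi_fact \<alpha> powr s) summable_on UNIV"
    and cont: "continuous_on UNIV \<phi>"
    and decay: "\<And>y. cmod (\<phi> y) \<le> N * exp (- ((s + 1) * gs_weight s y))"
  defines "f \<equiv> \<lambda>x. \<Sum>\<^sub>\<infinity>\<alpha>. c \<alpha> * of_real (mi_pow x \<alpha>)"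
  shows integrable_power_series_cnj: "integrable lborel (\<lambda>x. f x * cnj (\<phi> x))"
    and has_sum_fun_dual_power_series:
      "((\<lambda>\<alpha>. fun_dual (\<lambda>x. c \<alpha> * of_real (mi_pow x \<alpha>)) \<phi>) has_sum fun_dual f \<phi>) UNIV"
proof -
  let ?F = "\<lambda>\<alpha> x. c \<alpha> * of_real (mi_pow x \<alpha>) * cnj (\<phi> x)"
  have meas: "?F \<alpha> \<in> borel_measurable lborel" for \<alpha>
    using cont by (simp, intro borel_measurable_continuous_onI continuous_intros)
  have bound: "norm (?F \<alpha> x) \<le> (cmod (c \<alpha>) * mi_fact \<alpha> powr s) * (N * exp (- gs_weight s x))" for \<alpha> x
    using mult_left_mono[OF mi_pow_cnj_bound[where \<phi> = \<phi> and y = x and \<alpha> = \<alpha>, OF s decay], of "cmod (c \<alpha>)"]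
    by (simp add: norm_mult mult_ac)
  have w: "integrable lborel (\<lambda>x :: real ^ 'd. N * exp (- gs_weight s x))"
    by (intro integrable_mult_right integrable_exp_minus_gs_weight s)
  have eq: "(\<Sum>\<^sub>\<infinity>\<alpha>. ?F \<alpha> x) = f x * cnj (\<phi> x)" for x
    unfolding f_def by (rule infsum_cmult_left')
  show "integrable lborel (\<lambda>x. f x * cnj (\<phi> x))"
    using integrable_infsum_dominated[OF meas bound c w] unfolding eq .
  show "((\<lambda>\<alpha>. fun_dual (\<lambda>x. c \<alpha> * of_real (mi_pow x \<alpha>)) \<phi>) has_sum fun_dual f \<phi>) UNIV"
    using has_sum_integral_dominated[OF meas bound c w] unfolding eq fun_dual_def .
qed

lemma fun_dual_monomial:
  "fun_dual (\<lambda>x. a * of_real (mi_pow x \<alpha>)) \<phi> = a * (LINT y|lborel. of_real (mi_pow y \<alpha>) * cnj (\<phi> y))"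
  unfolding fun_dual_def by (simp add: mult.assoc)

lemma norm_has_sum_le:
  fixes F :: "'i \<Rightarrow> 'a::banach"
  assumes "(F has_sum S) A" "\<And>i. i \<in> A \<Longrightarrow> norm (F i) \<le> b i" "b summable_on A"
  shows "norm S \<le> infsum b A"
proof -
  have "(\<lambda>i. norm (F i)) summable_on A"
    using assms(2) by (intro summable_on_comparison_test[OF assms(3)]) auto
  hence "norm (infsum F A) \<le> (\<Sum>\<^sub>\<infinity>i\<in>A. norm (F i))" "(\<Sum>\<^sub>\<infinity>i\<in>A. norm (F i)) \<le> infsum b A"
    using assms by (auto intro: norm_infsum_bound infsum_mono)
  thus ?thesis
    using infsumI[OF assms(1)] by simp
qed

text \<open>\<open>A\<close> determines \<open>H\<close>, then \<open>h\<close>, and then the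
  constant \<open>M\<close> of the window. Everything depending on \<open>A\<close> thus ends up in
  \<open>C\<close>, while the growth rate in \<open>x\<close> stays fixed.\<close>

lemma stft_power_series_bound:
  fixes \<eta> :: "real ^ 'd::finite \<Rightarrow> complex"
  assumes s: "s > 0" and t: "t > 0" and st: "s + t \<ge> 1" and "A > 0" and \<eta>: "\<eta> \<in> gs_space s t"
    and c: "\<And>r::real. r > 0 \<Longrightarrow> (\<lambda>\<alpha>. cmod (c \<alpha>) * r ^ mi_abs \<alpha> * mi_fact \<alpha> powr s) summable_on UNIV"
  defines "f \<equiv> \<lambda>x. \<Sum>\<^sub>\<infinity>\<alpha>. c \<alpha> * of_real (mi_pow x \<alpha>)"
  obtains C where "C \<ge> 0"
    "\<And>x \<xi>. cmod (stft \<eta> (fun_dual f) x \<xi>) \<le>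
       C * exp (2 powr (1/s) * (s + 1) * gs_weight s x - A * gs_weight t \<xi>)"
proof -
  let ?B = "2 powr (1/s) * (s + 1)"
  obtain H where H: "H > 0" "H \<le> 2"
    "\<And>(x :: real ^ 'd) v C. v \<ge> 0 \<Longrightarrow> C \<ge> 0 \<Longrightarrow>
       (\<And>i n. \<bar>x $ i\<bar> ^ n * v \<le> C * H ^ n * fact n powr t) \<Longrightarrow>
       v \<le> 2 powr t * C * exp (- (A * gs_weight t x))"
    using moments_imp_weight_decay[OF t \<open>A > 0\<close>, of 2] by auto
  \<comment> \<open>The Leibniz sum returns \<open>(2 * h) ^ n\<close>, which has to match
    \<open>H ^ n\<close>; the bound \<open>H \<le> 2\<close> gives \<open>h \<le> 1\<close>.\<close>
  define h where "h = H / 2"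
  have h: "0 < h" "h \<le> 1"
    using H by (auto simp: h_def)
  have "?B > 0"
    using s by simp
  then obtain h' K where K: "h' > 0" "K \<ge> 0"
    "\<And>(f :: real ^ 'd \<Rightarrow> complex) \<beta> x. f \<in> gs_space s t \<Longrightarrow>
       cmod (mi_deriv \<beta> f x) \<le>
         K * enn2real (gs_seminorm s t h' f) * h ^ mi_abs \<beta> * mi_fact \<beta> powr t * exp (- (?B * gs_weight s x))"
    using gs_space_exp_decay[OF s _ h(1), of ?B] by metis
  define M where "M = K * enn2real (gs_seminorm s t h' \<eta>)"
  define J\<^sub>0 where "J\<^sub>0 = (LINT y|lborel. exp (- gs_weight s (y :: real ^ 'd)))"
  define Q where "Q = (\<Sum>\<^sub>\<infinity>\<alpha>. cmod (c \<alpha>) * (2 / h) ^ mi_abs \<alpha> * mi_fact \<alpha> powr s)"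
  have M: "M \<ge> 0"
    using K by (simp add: M_def)
  have J\<^sub>0: "J\<^sub>0 \<ge> 0"
    unfolding J\<^sub>0_def by (intro integral_nonneg_AE) auto
  have Q: "Q \<ge> 0"
    unfolding Q_def using h by (intro infsum_nonneg) auto
  have decay: "cmod ((partial_deriv i ^^ m) \<eta> y) \<le> M * h ^ m * fact m powr t * exp (- (?B * gs_weight s y))" for i m y
    using K(3)[OF \<eta>, where \<beta> = "mi_single i m"] by (simp add: M_def mi_deriv_single)
  note mono = stft_monomial_bound[OF s t st h M gs_spaceD(1)[OF \<eta>] decay]
  define D where "D = (2 * pi) powr (- real CARD('d) / 2)"
  have "D \<ge> 0"
    by (simp add: D_def)
  define C where "C = D * (2 powr t * (M * J\<^sub>0 * Q))"
  show ?thesis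
  proof (rule that[of C])
    show "C \<ge> 0"
      using M J\<^sub>0 Q \<open>D \<ge> 0\<close> by (simp add: C_def)
    fix x \<xi> :: "real ^ 'd"
    define \<phi> where "\<phi> = modulate \<xi> (translate x \<eta>)"
    have cont: "continuous_on UNIV \<phi>"
      unfolding \<phi>_def by (intro smooth_continuous_on smooth_modulate smooth_translate gs_spaceD(1)[OF \<eta>])
    have sum: "((\<lambda>\<alpha>. fun_dual (\<lambda>x. c \<alpha> * of_real (mi_pow x \<alpha>)) \<phi>) has_sum fun_dual f \<phi>) UNIV"
      unfolding f_def
      by (rule has_sum_fun_dual_power_series[OF s summable_coefficients[OF c] cont mono(1)[where x = x and \<xi> = \<xi>, folded \<phi>_def]])
    have "\<bar>\<xi> $ i\<bar> ^ n * cmod (fun_dual f \<phi>) \<le> (M * exp (?B * gs_weight s x) * J\<^sub>0 * Q) * H ^ n * fact n powr t" for i n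
    proof -
      let ?q = "M * exp (?B * gs_weight s x) * J\<^sub>0 * H ^ n * fact n powr t"
      have "((\<lambda>\<alpha>. of_real (\<xi> $ i) ^ n * fun_dual (\<lambda>x. c \<alpha> * of_real (mi_pow x \<alpha>)) \<phi>) has_sum
          of_real (\<xi> $ i) ^ n * fun_dual f \<phi>) UNIV"
        by (intro has_sum_cmult_right sum)
      moreover have "cmod (of_real (\<xi> $ i) ^ n * fun_dual (\<lambda>x. c \<alpha> * of_real (mi_pow x \<alpha>)) \<phi>) \<le>
          (cmod (c \<alpha>) * (2 / h) ^ mi_abs \<alpha> * mi_fact \<alpha> powr s) * ?q" for \<alpha>
      proof -
        have "cmod (of_real (\<xi> $ i) ^ n * fun_dual (\<lambda>x. c \<alpha> * of_real (mi_pow x \<alpha>)) \<phi>) =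
            cmod (c \<alpha>) * (\<bar>\<xi> $ i\<bar> ^ n * cmod (LINT y|lborel. of_real (mi_pow y \<alpha>) * cnj (\<phi> y)))"
          by (simp add: fun_dual_monomial norm_mult norm_power mult_ac)
        also have "\<dots> \<le> cmod (c \<alpha>) * (M * exp (?B * gs_weight s x) * J\<^sub>0 *
            ((2 / h) ^ mi_abs \<alpha> * mi_fact \<alpha> powr s) * (2 * h) ^ n * fact n powr t)"
          using mono(2)[where x = x and \<xi> = \<xi> and i = i and n = n and \<alpha> = \<alpha>] unfolding \<phi>_def J\<^sub>0_def by (intro mult_left_mono) auto
        also have "\<dots> = (cmod (c \<alpha>) * (2 / h) ^ mi_abs \<alpha> * mi_fact \<alpha> powr s) * ?q"
          by (simp add: h_def)
        finally show ?thesis .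
      qed
      \<comment> \<open>The moments are summed term by term; the series of bounds converges by the
        summability hypothesis at \<open>r = 2 / h\<close>.\<close>
      ultimately have "cmod (of_real (\<xi> $ i) ^ n * fun_dual f \<phi>) \<le>
          (\<Sum>\<^sub>\<infinity>\<alpha>. (cmod (c \<alpha>) * (2 / h) ^ mi_abs \<alpha> * mi_fact \<alpha> powr s) * ?q)"
        using c[of "2 / h"] h by (intro norm_has_sum_le summable_on_cmult_left) auto
      also have "\<dots> = Q * ?q"
        unfolding Q_def by (rule infsum_cmult_left')
      finally show ?thesis
        by (simp add: norm_mult norm_power mult_ac)
    qed
    hence "cmod (fun_dual f \<phi>) \<le> 2 powr t * (M * exp (?B * gs_weight s x) * J\<^sub>0 * Q) * exp (- (A * gs_weight t \<xi>))"
      using M J\<^sub>0 Q by (intro H(3)) auto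
    hence "D * cmod (fun_dual f \<phi>) \<le>
        D * (2 powr t * (M * exp (?B * gs_weight s x) * J\<^sub>0 * Q) * exp (- (A * gs_weight t \<xi>)))"
      using \<open>D \<ge> 0\<close> by (rule mult_left_mono)
    also have "\<dots> = C * (exp (?B * gs_weight s x) * exp (- (A * gs_weight t \<xi>)))"
      by (simp add: C_def)
    also have "exp (?B * gs_weight s x) * exp (- (A * gs_weight t \<xi>)) = exp (?B * gs_weight s x - A * gs_weight t \<xi>)"
      by (simp add: exp_add[symmetric])
    finally show "cmod (stft \<eta> (fun_dual f) x \<xi>) \<le> C * exp (?B * gs_weight s x - A * gs_weight t \<xi>)"
      by (simp add: stft_def norm_mult D_def \<phi>_def)
  qed
qed

section \<open>Wave front sets\<close>

lemma not_in_wave_frontI: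
  assumes "open U" "U \<subseteq> - {(0, 0)}" "z \<in> U"
    and "\<And>r. r > 0 \<Longrightarrow> \<exists>C. \<forall>\<rho>>0. \<forall>(x, \<xi>)\<in>U.
           exp (r * \<rho>) * cmod (stft \<psi> u (\<rho> powr t *\<^sub>R x) (\<rho> powr s *\<^sub>R \<xi>)) \<le> C"
  shows "z \<notin> wave_front t s \<psi> u"
proof -
  have "bdd_above {exp (r * \<rho>) * cmod (stft \<psi> u (\<rho> powr t *\<^sub>R x) (\<rho> powr s *\<^sub>R \<xi>)) | \<rho> x \<xi>. \<rho> > 0 \<and> (x, \<xi>) \<in> U}"
    if r: "r > 0" for r
  proof -
    obtain C where C: "\<forall>\<rho>>0. \<forall>(x, \<xi>)\<in>U.
        exp (r * \<rho>) * cmod (stft \<psi> u (\<rho> powr t *\<^sub>R x) (\<rho> powr s *\<^sub>R \<xi>)) \<le> C"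
      using assms(4)[OF r] by blast
    show ?thesis
      using C by (intro bdd_aboveI[where M = C]) blast
  qed
  thus ?thesis
    unfolding wave_front_def using assms(1-3) by blast
qed

lemma exp_mult_le_of_weights:
  fixes C v :: real
  assumes "v \<le> C * exp (b - a)" "r + b \<le> a" "C \<ge> 0"
  shows "exp r * v \<le> C"
proof -
  have "exp r * v \<le> exp r * (C * exp (b - a))"
    using assms by (intro mult_left_mono) auto
  also have "\<dots> = C * exp (r + b - a)"
    by (simp add: exp_add exp_diff)
  also have "\<dots> \<le> C * 1"
    using assms by (intro mult_left_mono) auto
  finally show ?thesis by simp
qed

text \<open>Decay in \<open>x\<close> excludes every point with nonzero first component; the second
  component is then nonzero because the wave front set omits the origin by definition.\<close>

lemma wave_front_subset_conormal:
  assumes "s > 0" "t > 0" "B \<ge> 0"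
    and bound: "\<And>A. A > 0 \<Longrightarrow> \<exists>C\<ge>0. \<forall>x \<xi>. cmod (stft \<psi> u x \<xi>) \<le> C * exp (B * gs_weight s \<xi> - A * gs_weight t x)"
  shows "wave_front t s \<psi> u \<subseteq> {0} \<times> (UNIV - {0})"
proof (rule subsetI)
  fix z assume z: "z \<in> wave_front t s \<psi> u"
  obtain x\<^sub>0 \<xi>\<^sub>0 where z_eq: "z = (x\<^sub>0, \<xi>\<^sub>0)"
    by (cases z)
  have "x\<^sub>0 = 0"
  proof (rule ccontr)
    assume "x\<^sub>0 \<noteq> 0"
    then obtain Y Z where YZ: "open Y" "open Z" "x\<^sub>0 \<in> Y" "\<xi>\<^sub>0 \<in> Z" "0 \<notin> Y"
      and scale: "\<And>r. r > 0 \<Longrightarrow> \<exists>A>0. \<forall>\<rho>>0. \<forall>y\<in>Y. \<forall>z\<in>Z.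
        r * \<rho> + B * gs_weight s (\<rho> powr s *\<^sub>R z) \<le> A * gs_weight t (\<rho> powr t *\<^sub>R y)"
      using gs_weight_scaling[OF assms(1-3), of x\<^sub>0 \<xi>\<^sub>0] by metis
    have "z \<notin> wave_front t s \<psi> u"
    \<comment> \<open>\<open>0 \<notin> Y\<close> keeps the product neighbourhood away from the
      origin.\<close>
    proof (rule not_in_wave_frontI[of "Y \<times> Z"])
      fix r :: real assume "r > 0"
      from scale[OF this] obtain A where A: "A > 0" "\<And>\<rho> y z. \<rho> > 0 \<Longrightarrow> y \<in> Y \<Longrightarrow> z \<in> Z \<Longrightarrow>
        r * \<rho> + B * gs_weight s (\<rho> powr s *\<^sub>R z) \<le> A * gs_weight t (\<rho> powr t *\<^sub>R y)"
        by blast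
      from bound[OF A(1)] obtain C where C: "C \<ge> 0"
        "\<And>x \<xi>. cmod (stft \<psi> u x \<xi>) \<le> C * exp (B * gs_weight s \<xi> - A * gs_weight t x)"
        by blast
      show "\<exists>C. \<forall>\<rho>>0. \<forall>(x, \<xi>)\<in>Y \<times> Z.
          exp (r * \<rho>) * cmod (stft \<psi> u (\<rho> powr t *\<^sub>R x) (\<rho> powr s *\<^sub>R \<xi>)) \<le> C"
        using A(2) by (intro exI[of _ C]) (auto intro!: exp_mult_le_of_weights[OF C(2) _ C(1)])
    qed (use YZ z_eq in \<open>auto intro: open_Times\<close>)
    thus False
      using z by simp
  qed
  thus "z \<in> {0} \<times> (UNIV - {0})"
    using z z_eq unfolding wave_front_def by auto
qed

text \<open>With \<open>s\<close> and \<open>t\<close> exchanged in \<open>wave_front\<close>,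
  \<open>x\<close> is scaled by \<open>\<rho> powr s\<close> and \<open>\<xi>\<close> by
  \<open>\<rho> powr t\<close>, so each weight still meets its own scaling and the factors
  \<open>Y\<close> and \<open>Z\<close> change places.\<close>

lemma wave_front_subset_base:
  assumes "s > 0" "t > 0" "B \<ge> 0"
    and bound: "\<And>A. A > 0 \<Longrightarrow> \<exists>C\<ge>0. \<forall>x \<xi>. cmod (stft \<psi> u x \<xi>) \<le> C * exp (B * gs_weight s x - A * gs_weight t \<xi>)"
  shows "wave_front s t \<psi> u \<subseteq> (UNIV - {0}) \<times> {0}"
proof (rule subsetI)
  fix z assume z: "z \<in> wave_front s t \<psi> u"
  obtain x\<^sub>0 \<xi>\<^sub>0 where z_eq: "z = (x\<^sub>0, \<xi>\<^sub>0)"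
    by (cases z)
  have "\<xi>\<^sub>0 = 0"
  proof (rule ccontr)
    assume "\<xi>\<^sub>0 \<noteq> 0"
    then obtain Y Z where YZ: "open Y" "open Z" "\<xi>\<^sub>0 \<in> Y" "x\<^sub>0 \<in> Z" "0 \<notin> Y"
      and scale: "\<And>r. r > 0 \<Longrightarrow> \<exists>A>0. \<forall>\<rho>>0. \<forall>y\<in>Y. \<forall>z\<in>Z.
        r * \<rho> + B * gs_weight s (\<rho> powr s *\<^sub>R z) \<le> A * gs_weight t (\<rho> powr t *\<^sub>R y)"
      using gs_weight_scaling[OF assms(1-3), of \<xi>\<^sub>0 x\<^sub>0] by metis
    have "z \<notin> wave_front s t \<psi> u"
    proof (rule not_in_wave_frontI[of "Z \<times> Y"])
      fix r :: real assume "r > 0"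
      from scale[OF this] obtain A where A: "A > 0" "\<And>\<rho> y z. \<rho> > 0 \<Longrightarrow> y \<in> Y \<Longrightarrow> z \<in> Z \<Longrightarrow>
        r * \<rho> + B * gs_weight s (\<rho> powr s *\<^sub>R z) \<le> A * gs_weight t (\<rho> powr t *\<^sub>R y)"
        by blast
      from bound[OF A(1)] obtain C where C: "C \<ge> 0"
        "\<And>x \<xi>. cmod (stft \<psi> u x \<xi>) \<le> C * exp (B * gs_weight s x - A * gs_weight t \<xi>)"
        by blast
      show "\<exists>C. \<forall>\<rho>>0. \<forall>(x, \<xi>)\<in>Z \<times> Y.
          exp (r * \<rho>) * cmod (stft \<psi> u (\<rho> powr s *\<^sub>R x) (\<rho> powr t *\<^sub>R \<xi>)) \<le> C"
        using A(2) by (intro exI[of _ C]) (auto intro!: exp_mult_le_of_weights[OF C(2) _ C(1)])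
    qed (use YZ z_eq in \<open>auto intro: open_Times\<close>)
    thus False
      using z by simp
  qed
  thus "z \<in> (UNIV - {0}) \<times> {0}"
    using z z_eq unfolding wave_front_def by auto
qed

section \<open>The series of derivatives of the Dirac distribution\<close>

lemma mi_D_at_0_bound:
  assumes "\<phi> \<in> gs_space t s"
  shows "cmod (mi_D \<alpha> \<phi> 0) \<le> mi_fact \<alpha> powr s * enn2real (gs_seminorm t s 1 \<phi>)"
  \<comment> \<open>\<open>mi_single undefined 0\<close> is the zero multi-index, whose monomial is
    1 even at the origin.\<close>
  using gs_seminorm_bound[OF gs_spaceD(2)[OF assms], of 1 0 "mi_single undefined 0" \<alpha>]
  by (simp add: cmod_mi_D mult.commute)

text \<open>The single seminorm with \<open>h = 1\<close> dominates all terms with summable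
  constants, which gives convergence and continuity of the sum at once.\<close>

lemma gs_dual_has_sum_dirac_series:
  fixes c :: "'d::finite multiindex \<Rightarrow> complex"
  assumes c: "(\<lambda>\<alpha>. cmod (c \<alpha>) * mi_fact \<alpha> powr s) summable_on UNIV"
  defines "u \<equiv> \<lambda>\<phi>. \<Sum>\<^sub>\<infinity>\<alpha>. c \<alpha> * dual_D \<alpha> dirac0 \<phi>"
  shows "gs_dual_has_sum t s (\<lambda>\<alpha> \<phi>. c \<alpha> * dual_D \<alpha> dirac0 \<phi>) u"
proof -
  let ?v = "\<lambda>\<alpha> \<phi>. c \<alpha> * dual_D \<alpha> dirac0 \<phi>"
  define Q where "Q = (\<Sum>\<^sub>\<infinity>\<alpha>. cmod (c \<alpha>) * mi_fact \<alpha> powr s)"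
  have Q: "Q \<ge> 0"
    unfolding Q_def by (intro infsum_nonneg) auto
  have bound: "cmod (?v \<alpha> \<phi>) \<le> cmod (c \<alpha>) * mi_fact \<alpha> powr s * enn2real (gs_seminorm t s 1 \<phi>)"
    if "\<phi> \<in> gs_space t s" for \<alpha> \<phi>
    using mult_left_mono[OF mi_D_at_0_bound[OF that, of \<alpha>], of "cmod (c \<alpha>)"]
    by (simp add: norm_mult dual_D_def dirac0_def mult.assoc)
  have lin: "?v \<alpha> (\<lambda>x. a * \<phi> x + b * \<eta> x) = cnj a * ?v \<alpha> \<phi> + cnj b * ?v \<alpha> \<eta>"
    if "\<phi> \<in> gs_space t s" "\<eta> \<in> gs_space t s" for \<alpha> a b and \<phi> \<eta> :: "real ^ 'd \<Rightarrow> complex"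
    using that by (simp add: dual_D_def dirac0_def mi_D_lincomb gs_spaceD(1) algebra_simps)
  have sum: "((\<lambda>\<alpha>. ?v \<alpha> \<phi>) has_sum u \<phi>) UNIV" if "\<phi> \<in> gs_space t s" for \<phi>
  proof -
    have "(\<lambda>\<alpha>. cmod (?v \<alpha> \<phi>)) summable_on UNIV"
      using bound[OF that] by (intro summable_on_comparison_test[OF summable_on_cmult_left[OF c]]) auto
    thus ?thesis
      unfolding u_def by (rule has_sum_infsum[OF abs_summable_summable])
  qed
  have "u \<in> gs_dual t s"
  proof (rule gs_dualI[of 1 Q])
    fix a b and \<phi> \<eta> :: "real ^ 'd \<Rightarrow> complex" assume in_space: "\<phi> \<in> gs_space t s" "\<eta> \<in> gs_space t s"
    have "((\<lambda>\<alpha>. ?v \<alpha> (\<lambda>x. a * \<phi> x + b * \<eta> x)) has_sum (cnj a * u \<phi> + cnj b * u \<eta>)) UNIV"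
      unfolding lin[OF in_space] by (intro has_sum_add has_sum_cmult_right sum in_space)
    with sum[OF gs_space_lincomb[OF in_space]]
    show "u (\<lambda>x. a * \<phi> x + b * \<eta> x) = cnj a * u \<phi> + cnj b * u \<eta>"
      by (rule has_sum_unique)
  next
    fix \<phi> :: "real ^ 'd \<Rightarrow> complex" assume \<phi>: "\<phi> \<in> gs_space t s"
    show "cmod (u \<phi>) \<le> Q * enn2real (gs_seminorm t s 1 \<phi>)"
      using norm_has_sum_le[OF sum[OF \<phi>] bound[OF \<phi>] summable_on_cmult_left[OF c]]
      by (simp only: infsum_cmult_left' Q_def)
  qed (use Q in auto)
  moreover have "?v \<alpha> \<in> gs_dual t s" for \<alpha>
    using lin bound[of _ \<alpha>] by (intro gs_dualI[of 1 "cmod (c \<alpha>) * mi_fact \<alpha> powr s"]) auto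
  ultimately show ?thesis
    unfolding gs_dual_has_sum_def by (simp add: sum)
qed

text \<open>The bounds on the derivatives of the shifted window at 0 are uniform in
  \<open>\<alpha>\<close> up to \<open>2 ^ mi_abs \<alpha> * mi_fact \<alpha> powr s\<close>, so
  summability at \<open>r = 2\<close> lets the exponential factor be taken out of the sum.\<close>

lemma stft_dirac_series_bound:
  fixes c :: "'d::finite multiindex \<Rightarrow> complex"
  assumes "s > 0" "t > 0" "A > 0" and \<psi>: "\<psi> \<in> gs_space t s"
    and c: "\<And>r::real. r > 0 \<Longrightarrow> (\<lambda>\<alpha>. cmod (c \<alpha>) * r ^ mi_abs \<alpha> * mi_fact \<alpha> powr s) summable_on UNIV"
  defines "u \<equiv> \<lambda>\<phi>. \<Sum>\<^sub>\<infinity>\<alpha>. c \<alpha> * dual_D \<alpha> dirac0 \<phi>"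
  obtains C where "C \<ge> 0"
    "\<And>x \<xi>. cmod (stft \<psi> u x \<xi>) \<le> C * exp (s * CARD('d) * gs_weight s \<xi> - A * gs_weight t x)"
proof -
  obtain C where C: "C \<ge> 0"
    "\<And>\<alpha> (x :: real ^ 'd) \<xi>. cmod (mi_D \<alpha> (modulate \<xi> (translate x \<psi>)) 0) \<le>
       C * exp (s * CARD('d) * gs_weight s \<xi> - A * gs_weight t x) * (2 ^ mi_abs \<alpha> * mi_fact \<alpha> powr s)"
    using mi_D_modulate_translate_bound[OF assms(1-4)] by metis
  define Q where "Q = (\<Sum>\<^sub>\<infinity>\<alpha>. cmod (c \<alpha>) * 2 ^ mi_abs \<alpha> * mi_fact \<alpha> powr s)"
  have Q: "Q \<ge> 0"
    unfolding Q_def by (intro infsum_nonneg) auto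
  define D where "D = (2 * pi) powr (- real CARD('d) / 2)"
  have D: "D \<ge> 0"
    by (simp add: D_def)
  show ?thesis
  proof (rule that[of "D * (Q * C)"])
    fix x \<xi> :: "real ^ 'd"
    let ?\<phi> = "modulate \<xi> (translate x \<psi>)"
    let ?e = "exp (s * CARD('d) * gs_weight s \<xi> - A * gs_weight t x)"
    have bound: "cmod (c \<alpha> * dual_D \<alpha> dirac0 ?\<phi>) \<le> cmod (c \<alpha>) * 2 ^ mi_abs \<alpha> * mi_fact \<alpha> powr s * (C * ?e)" for \<alpha>
      using mult_left_mono[OF C(2)[of \<alpha> \<xi> x], of "cmod (c \<alpha>)"]
      by (simp add: norm_mult dual_D_def dirac0_def mult_ac)
    have summable: "(\<lambda>\<alpha>. cmod (c \<alpha>) * 2 ^ mi_abs \<alpha> * mi_fact \<alpha> powr s * (C * ?e)) summable_on UNIV"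
      by (rule summable_on_cmult_left[OF c]) simp
    have "(\<lambda>\<alpha>. cmod (c \<alpha> * dual_D \<alpha> dirac0 ?\<phi>)) summable_on UNIV"
      using bound by (intro summable_on_comparison_test[OF summable]) auto
    hence "((\<lambda>\<alpha>. c \<alpha> * dual_D \<alpha> dirac0 ?\<phi>) has_sum u ?\<phi>) UNIV"
      unfolding u_def by (rule has_sum_infsum[OF abs_summable_summable])
    from norm_has_sum_le[OF this bound summable]
    have "cmod (u ?\<phi>) \<le> Q * (C * ?e)"
      by (simp only: infsum_cmult_left' Q_def)
    hence "D * cmod (u ?\<phi>) \<le> D * (Q * (C * ?e))"
      using D by (rule mult_left_mono)
    thus "cmod (stft \<psi> u x \<xi>) \<le> D * (Q * C) * ?e"
      by (simp add: stft_def norm_mult D_def mult.assoc)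
  qed (use C Q D in auto)
qed

section \<open>The power series as an ultradistribution\<close>

lemma
  fixes c :: "'d::finite multiindex \<Rightarrow> complex"
  assumes s: "s > 0" and c: "(\<lambda>\<alpha>. cmod (c \<alpha>) * mi_fact \<alpha> powr s) summable_on UNIV"
  defines "f \<equiv> \<lambda>x. \<Sum>\<^sub>\<infinity>\<alpha>. c \<alpha> * of_real (mi_pow x \<alpha>)"
  shows integrable_power_series_gs_space: "\<forall>\<phi>\<in>gs_space s t. integrable lborel (\<lambda>x. f x * cnj (\<phi> x))"
    and gs_dual_has_sum_power_series:
      "gs_dual_has_sum s t (\<lambda>\<alpha>. fun_dual (\<lambda>x. c \<alpha> * of_real (mi_pow x \<alpha>))) (fun_dual f)"
proof -
  let ?v = "\<lambda>\<alpha>. fun_dual (\<lambda>x. c \<alpha> * of_real (mi_pow x \<alpha>))"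
  obtain h K where K: "h > 0" "K \<ge> 0"
    "\<And>(\<phi> :: real ^ 'd \<Rightarrow> complex) \<beta> x. \<phi> \<in> gs_space s t \<Longrightarrow>
       cmod (mi_deriv \<beta> \<phi> x) \<le>
         K * enn2real (gs_seminorm s t h \<phi>) * 1 ^ mi_abs \<beta> * mi_fact \<beta> powr t * exp (- ((s + 1) * gs_weight s x))"
    using gs_space_exp_decay[OF s, of "s + 1" 1] s by (metis add_pos_pos zero_less_one)
  define J\<^sub>0 where "J\<^sub>0 = (LINT y|lborel. exp (- gs_weight s (y :: real ^ 'd)))"
  define Q where "Q = (\<Sum>\<^sub>\<infinity>\<alpha>. cmod (c \<alpha>) * mi_fact \<alpha> powr s)"
  have J\<^sub>0: "J\<^sub>0 \<ge> 0"
    unfolding J\<^sub>0_def by (intro integral_nonneg_AE) auto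
  have Q: "Q \<ge> 0"
    unfolding Q_def by (intro infsum_nonneg) auto
  have decay: "cmod (\<phi> y) \<le> K * enn2real (gs_seminorm s t h \<phi>) * exp (- ((s + 1) * gs_weight s y))"
    if "\<phi> \<in> gs_space s t" for \<phi> :: "real ^ 'd \<Rightarrow> complex" and y
    \<comment> \<open>The zero multi-index turns the estimate for derivatives into one for the
      function itself.\<close>
    using K(3)[OF that, where \<beta> = "mi_single undefined 0"] by (simp add: mi_deriv_single)
  note cont = smooth_continuous_on[OF gs_spaceD(1)]
  show "\<forall>\<phi>\<in>gs_space s t. integrable lborel (\<lambda>x. f x * cnj (\<phi> x))"
    unfolding f_def using integrable_power_series_cnj[OF s c cont decay] by blast
  have sum: "((\<lambda>\<alpha>. ?v \<alpha> \<phi>) has_sum fun_dual f \<phi>) UNIV" if "\<phi> \<in> gs_space s t" for \<phi>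
    unfolding f_def using has_sum_fun_dual_power_series[OF s c cont decay] that by blast
  have bound: "cmod (?v \<alpha> \<phi>) \<le> cmod (c \<alpha>) * mi_fact \<alpha> powr s * (K * J\<^sub>0 * enn2real (gs_seminorm s t h \<phi>))"
    if "\<phi> \<in> gs_space s t" for \<alpha> \<phi>
    using mult_left_mono[OF integral_mi_pow_cnj_bound[OF s cont[OF that] decay[OF that], where \<alpha> = \<alpha>],
        of "cmod (c \<alpha>)"]
    unfolding J\<^sub>0_def[symmetric] by (simp add: fun_dual_monomial norm_mult mult_ac)
  have lin: "?v \<alpha> (\<lambda>x. a * \<phi> x + b * \<eta> x) = cnj a * ?v \<alpha> \<phi> + cnj b * ?v \<alpha> \<eta>"
    if "\<phi> \<in> gs_space s t" "\<eta> \<in> gs_space s t" for \<alpha> a b and \<phi> \<eta> :: "real ^ 'd \<Rightarrow> complex"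
  proof -
    note int = integrable_mi_pow_cnj[OF s cont decay, where \<alpha> = \<alpha>]
    have "(LINT y|lborel. of_real (mi_pow y \<alpha>) * cnj (a * \<phi> y + b * \<eta> y)) =
        (LINT y|lborel. cnj a * (of_real (mi_pow y \<alpha>) * cnj (\<phi> y)) + cnj b * (of_real (mi_pow y \<alpha>) * cnj (\<eta> y)))"
      by (intro Bochner_Integration.integral_cong) (auto simp: algebra_simps)
    also have "\<dots> = cnj a * (LINT y|lborel. of_real (mi_pow y \<alpha>) * cnj (\<phi> y)) +
        cnj b * (LINT y|lborel. of_real (mi_pow y \<alpha>) * cnj (\<eta> y))"
      using int[OF that(1) that(1)] int[OF that(2) that(2)] by simp
    finally show ?thesis
      by (simp add: fun_dual_monomial algebra_simps)
  qed
  have "fun_dual f \<in> gs_dual s t"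
  proof (rule gs_dualI[OF K(1), of "Q * (K * J\<^sub>0)"])
    fix a b and \<phi> \<eta> :: "real ^ 'd \<Rightarrow> complex" assume in_space: "\<phi> \<in> gs_space s t" "\<eta> \<in> gs_space s t"
    have "((\<lambda>\<alpha>. ?v \<alpha> (\<lambda>x. a * \<phi> x + b * \<eta> x)) has_sum (cnj a * fun_dual f \<phi> + cnj b * fun_dual f \<eta>)) UNIV"
      unfolding lin[OF in_space] by (intro has_sum_add has_sum_cmult_right sum in_space)
    with sum[OF gs_space_lincomb[OF in_space]]
    show "fun_dual f (\<lambda>x. a * \<phi> x + b * \<eta> x) = cnj a * fun_dual f \<phi> + cnj b * fun_dual f \<eta>"
      by (rule has_sum_unique)
  next
    fix \<phi> :: "real ^ 'd \<Rightarrow> complex" assume \<phi>: "\<phi> \<in> gs_space s t"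
    show "cmod (fun_dual f \<phi>) \<le> Q * (K * J\<^sub>0) * enn2real (gs_seminorm s t h \<phi>)"
      using norm_has_sum_le[OF sum[OF \<phi>] bound[OF \<phi>] summable_on_cmult_left[OF c]]
      unfolding infsum_cmult_left' Q_def by (simp only: mult.assoc)
  qed (use Q K J\<^sub>0 in auto)
  moreover have "?v \<alpha> \<in> gs_dual s t" for \<alpha>
    using lin bound[of _ \<alpha>] K J\<^sub>0
    by (intro gs_dualI[of h "cmod (c \<alpha>) * mi_fact \<alpha> powr s * (K * J\<^sub>0)"]) (auto simp: mult.assoc)
  ultimately show "gs_dual_has_sum s t ?v (fun_dual f)"
    unfolding gs_dual_has_sum_def by (simp add: sum)
qed

lemma abs_summable_power_series:
  assumes s: "s > 0"
    and c: "\<And>r::real. r > 0 \<Longrightarrow> (\<lambda>\<alpha>. cmod (c \<alpha>) * r ^ mi_abs \<alpha> * mi_fact \<alpha> powr s) summable_on UNIV"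
  shows "(\<lambda>\<alpha>. cmod (c \<alpha> * of_real (mi_pow x \<alpha>))) summable_on UNIV"
proof (rule summable_on_comparison_test)
  show "(\<lambda>\<alpha>. cmod (c \<alpha>) * mi_fact \<alpha> powr s * exp (s * gs_weight s x)) summable_on UNIV"
    by (intro summable_on_cmult_left summable_coefficients c)
  show "cmod (c \<alpha> * of_real (mi_pow x \<alpha>)) \<le> cmod (c \<alpha>) * mi_fact \<alpha> powr s * exp (s * gs_weight s x)" for \<alpha>
    using mult_left_mono[OF mi_pow_le_weight[OF s, of x \<alpha>], of "cmod (c \<alpha>)"]
    by (simp add: norm_mult mult.assoc)
qed auto

text \<open>The convergence clauses certify that \<open>u\<close> and \<open>f\<close> are the
  intended objects: an \<open>infsum\<close> or an integral without convergence would silently be 0.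
  The windows are arbitrary nonzero test functions, so no particular choice is built into the
  inclusions.\<close>

theorem proposition7p3:
  fixes s t :: real
    and c :: "'d::finite multiindex \<Rightarrow> complex"
    and u :: "'d functional"
    and f :: "real ^ 'd \<Rightarrow> complex"
    and \<psi> \<eta> :: "real ^ 'd \<Rightarrow> complex"
  assumes "s > 0" and "t > 0" and "s + t > 1"
    and "\<And>r::real. r > 0 \<Longrightarrow>
           (\<lambda>\<alpha>. cmod (c \<alpha>) * r ^ mi_abs \<alpha> * mi_fact \<alpha> powr s) summable_on UNIV"
    and u: "u = (\<lambda>\<phi>. \<Sum>\<^sub>\<infinity>\<alpha>. c \<alpha> * dual_D \<alpha> dirac0 \<phi>)"
    and f: "f = (\<lambda>x. \<Sum>\<^sub>\<infinity>\<alpha>. c \<alpha> * of_real (mi_pow x \<alpha>))"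
    and "\<psi> \<in> gs_space t s" and "\<psi> \<noteq> (\<lambda>x. 0)"
    and "\<eta> \<in> gs_space s t" and "\<eta> \<noteq> (\<lambda>x. 0)"
  shows "gs_dual_has_sum t s (\<lambda>\<alpha> \<phi>. c \<alpha> * dual_D \<alpha> dirac0 \<phi>) u \<and>
         (\<forall>x. (\<lambda>\<alpha>. cmod (c \<alpha> * of_real (mi_pow x \<alpha>))) summable_on UNIV) \<and>
         (\<forall>\<phi>\<in>gs_space s t. integrable lborel (\<lambda>x. f x * cnj (\<phi> x))) \<and>
         gs_dual_has_sum s t (\<lambda>\<alpha>. fun_dual (\<lambda>x. c \<alpha> * of_real (mi_pow x \<alpha>))) (fun_dual f) \<and>
         wave_front t s \<psi> u \<subseteq> {0} \<times> (UNIV - {0}) \<and>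
         wave_front s t \<eta> (fun_dual f) \<subseteq> (UNIV - {0}) \<times> {0}"
proof (intro conjI allI)
  note c = assms(4)
  note c1 = summable_coefficients[OF c]
  show "gs_dual_has_sum t s (\<lambda>\<alpha> \<phi>. c \<alpha> * dual_D \<alpha> dirac0 \<phi>) u"
    unfolding u by (rule gs_dual_has_sum_dirac_series[OF c1])
  show "(\<lambda>\<alpha>. cmod (c \<alpha> * of_real (mi_pow x \<alpha>))) summable_on UNIV" for x
    by (rule abs_summable_power_series[OF assms(1) c])
  show "\<forall>\<phi>\<in>gs_space s t. integrable lborel (\<lambda>x. f x * cnj (\<phi> x))"
    unfolding f by (rule integrable_power_series_gs_space[OF assms(1) c1])
  show "gs_dual_has_sum s t (\<lambda>\<alpha>. fun_dual (\<lambda>x. c \<alpha> * of_real (mi_pow x \<alpha>))) (fun_dual f)"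
    unfolding f by (rule gs_dual_has_sum_power_series[OF assms(1) c1])
  show "wave_front t s \<psi> u \<subseteq> {0} \<times> (UNIV - {0})"
  proof (rule wave_front_subset_conormal[OF assms(1,2)])
    show "\<exists>C\<ge>0. \<forall>x \<xi>. cmod (stft \<psi> u x \<xi>) \<le>
        C * exp (s * CARD('d) * gs_weight s \<xi> - A * gs_weight t x)" if "A > 0" for A
      unfolding u by (rule stft_dirac_series_bound[OF assms(1,2) that assms(7) c]) blast+
  qed (use assms in auto)
  show "wave_front s t \<eta> (fun_dual f) \<subseteq> (UNIV - {0}) \<times> {0}"
  proof (rule wave_front_subset_base[OF assms(1,2)])
    show "\<exists>C\<ge>0. \<forall>x \<xi>. cmod (stft \<eta> (fun_dual f) x \<xi>) \<le>
        C * exp (2 powr (1/s) * (s + 1) * gs_weight s x - A * gs_weight t \<xi>)" if "A > 0" for A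
      unfolding f by (rule stft_power_series_bound[OF assms(1,2) less_imp_le[OF assms(3)] that assms(9) c]) blast+
  qed (use assms in auto)
qed

end
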